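(* A finitely generated ergodic equivalence relation of type $\mathrm{II}_1$ that is uniformly non-amenable has a trivial fundamental group.
   Context: Let $(X,\mu)$ be a standard non-atomic probability space. A measured equivalence relation $R$ on $(X,\mu)$ is an equivalence relation on $X$ with countable classes, Borel as a subset of $X\times X$, such that saturations of $\mu$-null sets are $\mu$-null. It is ergodic if every saturated measurable set has measure $0$ or $1$. A partial automorphism of $R$ is a bimeasurable bijection between measurable subsets of $X$ whose graph lies in $R$; $[R]$ is the group of (full) automorphisms of $R$, i.e. those with domain and image $X$. $R$ is of type $\mathrm{II}_1$ if $\mu$ is invariant under every partial automorphism of $R$. Put $R^x=\{(x,y)\in R\}$ and $\mathfrak h(E)=\int_X|E\cap R^x|\,d\mu(x)$ for measurable $E\subset R$. The fundamental group of $R$ is the multiplicative subgroup of $\mathbf{R}_+^*$ generated by the measures $\mu(Y)$ of all Borel subsets $Y\subset X$ (of positive measure) such that the restricted equivalence relation $R_{|Y}$ on $Y$ (with normalized measure) is isomorphic (orbit equivalent) to $R$; it is trivial if it equals $\{1\}$. A graphing of $R$ is a countable family $\Phi=\{\varphi_i\}$ of partial automorphisms of $R$ such that for almost every $(x,y)\in R$ one has $y=\psi_n\cdots\psi_1(x)$ for some $\psi_1,\dots,\psi_n\in\Phi\cup\Phi^{-1}$; equivalently, it is described by a measurable subset $K\subset R$ generating $R$ up to null sets. It is finite if it can be partitioned into finitely many partial automorphisms; $R$ is finitely generated if it has a finite graphing. Isoperimetric constant: for a finite graphing $K\subset R$, the Cayley graph $\Sigma=\Sigma_K=\coprod_{x\in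 X}\Sigma^x$ is the measurable field of graphs where $\Sigma^x$ has vertex set $R^x$ and edges the pairs $((x,y),(x,z))\in R^x\times R^x$ with $(y,z)\in K$. Let $\Sigma^{(1)}$ be its set of edges and $\nu^{(1)}(E)=\int_X|E\cap\Sigma^x|\,d\mu(x)$ for measurable $E\subset\Sigma^{(1)}$. A symmetric vertex of $\Sigma$ is the graph $\{(x,\varphi(x)):x\in X\}\subset R$ of an element $\varphi\in[R]$; two are disjoint if their intersection is $\mathfrak h$-null. For a finite set $A$ of symmetric vertices, $\partial_K A\subset\Sigma^{(1)}$ is the set of edges of $\Sigma$ with one vertex in (the union of) $A$ and the other outside. Then $h_K(R)=\inf_A\nu^{(1)}(\partial_KA)/|A|$ over non-empty finite sets $A$ of pairwise disjoint symmetric vertices of $\Sigma_K$, and $h(R)=\inf_K h_K(R)$ over all finite graphings $K$ of $R$. $R$ is uniformly non-amenable if $h(R)>0$. *)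

theory Defs
  imports "HOL-Probability.Probability" "HOL-Algebra.Generated_Groups"
begin

definition standard_borel :: "'a measure \<Rightarrow> bool" where
  "standard_borel M \<longleftrightarrow>
     (\<exists>T. completely_metrizable_space T \<and> second_countable T \<and> topspace T = space M \<and>
          sets M = sigma_sets (topspace T) {U. openin T U})"

definition nonatomic :: "'a measure \<Rightarrow> bool" where
  "nonatomic M \<longleftrightarrow>
     (\<forall>A\<in>sets M. emeasure M A > 0 \<longrightarrow>
        (\<exists>B\<in>sets M. B \<subseteq> A \<and> 0 < emeasure M B \<and> emeasure M B < emeasure M A))"

definition standard_nonatomic_prob_space :: "'a measure \<Rightarrow> bool" where
  "standard_nonatomic_prob_space M \<longleftrightarrow> prob_space M \<and> standard_borel M \<and> nonatomic M"

text \<open>Throughout, measurable sets are members of \<open>sets M\<close>, i.e. Borel sets (no completion).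
  The saturation of a set \<open>A\<close> is \<open>R `` A\<close>.\<close>

definition measured_equiv_rel :: "'a measure \<Rightarrow> ('a \<times> 'a) set \<Rightarrow> bool" where
  "measured_equiv_rel M R \<longleftrightarrow>
     equiv (space M) R \<and> (\<forall>x\<in>space M. countable (R `` {x})) \<and>
     R \<in> sets (M \<Otimes>\<^sub>M M) \<and> (\<forall>N\<in>null_sets M. R `` N \<in> null_sets M)"

definition ergodic_rel :: "'a measure \<Rightarrow> ('a \<times> 'a) set \<Rightarrow> bool" where
  "ergodic_rel M R \<longleftrightarrow>
     (\<forall>A\<in>sets M. R `` A = A \<longrightarrow> measure M A = 0 \<or> measure M A = 1)"

text \<open>Partially defined maps are total functions together with an explicit domain; their values
  outside the domain are irrelevant.\<close>

definition bimeasurable_bij ::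
    "'a measure \<Rightarrow> 'a set \<Rightarrow> 'b measure \<Rightarrow> 'b set \<Rightarrow> ('a \<Rightarrow> 'b) \<Rightarrow> bool" where
  "bimeasurable_bij M A N B f \<longleftrightarrow>
     A \<in> sets M \<and> B \<in> sets N \<and> bij_betw f A B \<and>
     f \<in> restrict_space M A \<rightarrow>\<^sub>M restrict_space N B \<and>
     the_inv_into A f \<in> restrict_space N B \<rightarrow>\<^sub>M restrict_space M A"

definition graph_on :: "'a set \<Rightarrow> ('a \<Rightarrow> 'b) \<Rightarrow> ('a \<times> 'b) set" where
  "graph_on A f = (\<lambda>x. (x, f x)) ` A"

definition partial_automorphism ::
    "'a measure \<Rightarrow> ('a \<times> 'a) set \<Rightarrow> 'a set \<Rightarrow> 'a set \<Rightarrow> ('a \<Rightarrow> 'a) \<Rightarrow> bool" where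
  "partial_automorphism M R A B f \<longleftrightarrow> bimeasurable_bij M A M B f \<and> graph_on A f \<subseteq> R"

definition full_group :: "'a measure \<Rightarrow> ('a \<times> 'a) set \<Rightarrow> ('a \<Rightarrow> 'a) set" where
  "full_group M R = {f. partial_automorphism M R (space M) (space M) f}"

definition type_II1 :: "'a measure \<Rightarrow> ('a \<times> 'a) set \<Rightarrow> bool" where
  "type_II1 M R \<longleftrightarrow>
     (\<forall>A B f. partial_automorphism M R A B f \<longrightarrow>
        (\<forall>E\<in>sets M. E \<subseteq> A \<longrightarrow> emeasure M (f ` E) = emeasure M E))"

text \<open>The mass \<open>\<integral> |E \<inter> R\<^sup>x| d\<mu>(x)\<close> of a subset \<open>E\<close> of \<open>R\<close>; the cardinality is the
  counting measure, which is infinite on infinite sets.\<close>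

definition rel_mass :: "'a measure \<Rightarrow> ('a \<times> 'a) set \<Rightarrow> ennreal" where
  "rel_mass M E = (\<integral>\<^sup>+ x. emeasure (count_space UNIV) {p\<in>E. fst p = x} \<partial>M)"


subsection \<open>Fundamental group\<close>

definition restrict_rel :: "('a \<times> 'a) set \<Rightarrow> 'a set \<Rightarrow> ('a \<times> 'a) set" where
  "restrict_rel R Y = R \<inter> (Y \<times> Y)"

definition normalized_restriction :: "'a measure \<Rightarrow> 'a set \<Rightarrow> 'a measure" where
  "normalized_restriction M Y = scale_measure (inverse (emeasure M Y)) (restrict_space M Y)"

text \<open>Isomorphism (orbit equivalence): a measure preserving isomorphism between conull Borel
  subsets that identifies the relations there.\<close>

definition isomorphic_rel ::
    "'a measure \<Rightarrow> ('a \<times> 'a) set \<Rightarrow> 'b measure \<Rightarrow> ('b \<times> 'b) set \<Rightarrow> bool" where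
  "isomorphic_rel M R N S \<longleftrightarrow>
     (\<exists>A B f. bimeasurable_bij M A N B f \<and>
        space M - A \<in> null_sets M \<and> space N - B \<in> null_sets N \<and>
        distr (restrict_space M A) (restrict_space N B) f = restrict_space N B \<and>
        (\<forall>x\<in>A. \<forall>y\<in>A. (x, y) \<in> R \<longleftrightarrow> (f x, f y) \<in> S))"

definition pos_real_group :: "real monoid" where
  "pos_real_group = \<lparr>carrier = {0<..}, mult = (*), one = 1\<rparr>"

definition fundamental_group :: "'a measure \<Rightarrow> ('a \<times> 'a) set \<Rightarrow> real set" where
  "fundamental_group M R =
     generate pos_real_group
       {measure M Y | Y. Y \<in> sets M \<and> emeasure M Y > 0 \<and>
          isomorphic_rel (normalized_restriction M Y) (restrict_rel R Y) M R}"


subsection \<open>Graphings\<close>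

text \<open>A graphing is given by a Borel subset \<open>K\<close> of \<open>R\<close>: almost every pair in \<open>R\<close> is joined by a
  finite path, possibly of length \<open>0\<close>, with steps in \<open>K \<union> K\<inverse>\<close>.\<close>

definition graphing :: "'a measure \<Rightarrow> ('a \<times> 'a) set \<Rightarrow> ('a \<times> 'a) set \<Rightarrow> bool" where
  "graphing M R K \<longleftrightarrow>
     K \<in> sets (M \<Otimes>\<^sub>M M) \<and> K \<subseteq> R \<and> rel_mass M (R - (K \<union> K\<inverse>)\<^sup>*) = 0"

definition finite_graphing :: "'a measure \<Rightarrow> ('a \<times> 'a) set \<Rightarrow> ('a \<times> 'a) set \<Rightarrow> bool" where
  "finite_graphing M R K \<longleftrightarrow>
     graphing M R K \<and>
     (\<exists>P. finite P \<and> partition_on K P \<and>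
        (\<forall>G\<in>P. \<exists>A B f. partial_automorphism M R A B f \<and> G = graph_on A f))"

definition finitely_generated_rel :: "'a measure \<Rightarrow> ('a \<times> 'a) set \<Rightarrow> bool" where
  "finitely_generated_rel M R \<longleftrightarrow> (\<exists>K. finite_graphing M R K)"


subsection \<open>Isoperimetric constant\<close>

text \<open>Edges are ordered pairs of vertices. Counting unordered pairs instead does not change the
  infimum over \<open>K\<close>, since \<open>K\<close> may be replaced by an antisymmetric graphing with the same
  unordered edges.\<close>

definition cayley_edges ::
    "('a \<times> 'a) set \<Rightarrow> ('a \<times> 'a) set \<Rightarrow> (('a \<times> 'a) \<times> ('a \<times> 'a)) set" where
  "cayley_edges R K =
     {((x, y), (x, z)) | x y z. (x, y) \<in> R \<and> (x, z) \<in> R \<and> (y, z) \<in> K}"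

definition edge_mass :: "'a measure \<Rightarrow> (('a \<times> 'a) \<times> ('a \<times> 'a)) set \<Rightarrow> ennreal" where
  "edge_mass M E = (\<integral>\<^sup>+ x. emeasure (count_space UNIV) {e\<in>E. fst (fst e) = x} \<partial>M)"

definition symmetric_vertices :: "'a measure \<Rightarrow> ('a \<times> 'a) set \<Rightarrow> ('a \<times> 'a) set set" where
  "symmetric_vertices M R = graph_on (space M) ` full_group M R"

definition disjoint_symmetric_families ::
    "'a measure \<Rightarrow> ('a \<times> 'a) set \<Rightarrow> ('a \<times> 'a) set set set" where
  "disjoint_symmetric_families M R =
     {F. finite F \<and> F \<noteq> {} \<and> F \<subseteq> symmetric_vertices M R \<and>
         pairwise (\<lambda>U V. rel_mass M (U \<inter> V) = 0) F}"

definition edge_boundary ::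
    "('a \<times> 'a) set \<Rightarrow> ('a \<times> 'a) set \<Rightarrow> ('a \<times> 'a) set set \<Rightarrow> (('a \<times> 'a) \<times> ('a \<times> 'a)) set" where
  "edge_boundary R K F = {(u, v) \<in> cayley_edges R K. (u \<in> \<Union>F) \<noteq> (v \<in> \<Union>F)}"

definition isoperimetric_const_wrt ::
    "'a measure \<Rightarrow> ('a \<times> 'a) set \<Rightarrow> ('a \<times> 'a) set \<Rightarrow> ennreal" where
  "isoperimetric_const_wrt M R K =
     (INF F\<in>disjoint_symmetric_families M R. edge_mass M (edge_boundary R K F) / of_nat (card F))"

definition isoperimetric_const :: "'a measure \<Rightarrow> ('a \<times> 'a) set \<Rightarrow> ennreal" where
  "isoperimetric_const M R = (INF K\<in>{K. finite_graphing M R K}. isoperimetric_const_wrt M R K)"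

definition uniformly_nonamenable :: "'a measure \<Rightarrow> ('a \<times> 'a) set \<Rightarrow> bool" where
  "uniformly_nonamenable M R \<longleftrightarrow> isoperimetric_const M R > 0"

end

theory Submission
  imports Defs
begin

text \<open>
  Suppose \<open>R\<close> restricted to \<open>Y\<close> is isomorphic to \<open>R\<close> with \<open>\<mu>(Y) < 1\<close>. Iterating the isomorphism gives
  such sets of arbitrarily small measure, and each inherits from a fixed finite graphing of \<open>R\<close>
  a graphing with the same number \<open>p\<close> of pieces. Enlarge a small one to a set \<open>Y\<close> of measure exactly
  \<open>1/n\<close>, at the cost of one more piece, and cut \<open>X\<close> into \<open>n\<close> copies of \<open>Y\<close> by partial automorphisms
  \<open>\<phi>\<^sub>i\<close>. The \<open>p + 1\<close> pieces together with the \<open>\<phi>\<^sub>i\<close> form a finite graphing of \<open>R\<close>. The \<open>n\<close> cyclic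
  shifts of the copies are pairwise disjoint symmetric vertices; no edge of a \<open>\<phi>\<^sub>i\<close> leaves their union, so
  every fibre contains at most \<open>2(p + 1)\<close> boundary edges. Thus \<open>h(R) \<le> 2(p + 1)/n\<close> for arbitrarily
  large \<open>n\<close>, which contradicts \<open>h(R) > 0\<close>.

  That the copies exist uses ergodicity for the group generated by a graphing, where the exceptional
  set of points, a projection of a Borel set, has to be contained in a Borel null set. This is the
  measurable projection theorem for standard Borel spaces, proved via Choquet's capacity argument.
\<close>

text \<open>Generating a restriction to a set of measure \<open>1 / n\<close> can take a number of
  pieces that grows with \<open>n\<close>. The isomorphism supplies \<open>p\<close> pieces at every
  scale, and this is what keeps the boundary bounded.

  The measures obtained are powers \<open>s = t ^ k\<close>, which need not be reciprocals of
  integers. For \<open>n = nat \<lfloor>1 / s\<rfloor>\<close> the number \<open>1 / n\<close> lies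
  between \<open>s\<close> and \<open>2 * s\<close>, so the added set is no larger than the small
  copy and a single partial automorphism ties it to the copy.

  Over \<open>x\<close> the family of shifts consists of the points lying above one base point
  \<open>a\<close> of \<open>Y\<close>. Of these only \<open>a\<close> itself is in
  \<open>Y\<close>, and a generator of \<open>Y\<close> has at most one edge leaving
  \<open>a\<close> and one entering it; this gives the factor 2.

  Sets are Borel without completion, and \<open>rel_mass\<close> integrates a function not known to
  be measurable: its vanishing only says that Borel subsets of the projection are null. The
  projection theorem turns this into a Borel null set containing the projection. Words in a graphing
  then give countably many partial injections covering \<open>R\<close> off a null set, enough for a
  greedy matching.\<close>

subsection \<open>Measurable projection\<close>

context Metric_space
begin

text \<open>A Suslin operation on measurable rectangles: the \<open>n\<close>-th rectangle depends only on the first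
  \<open>n\<close> entries of the branch \<open>f\<close>, and the closed factors shrink along every branch.\<close>

definition suslin_scheme ::
    "'b measure \<Rightarrow> (nat \<Rightarrow> (nat \<Rightarrow> nat) \<Rightarrow> 'b set) \<Rightarrow> (nat \<Rightarrow> (nat \<Rightarrow> nat) \<Rightarrow> 'a set) \<Rightarrow> bool" where
  "suslin_scheme W A C \<longleftrightarrow> (\<forall>n f. A n f \<in> sets W) \<and> (\<forall>n f. closedin mtopology (C n f)) \<and>
     (\<forall>n f g. (\<forall>i<n. f i = g i) \<longrightarrow> A n f = A n g \<and> C n f = C n g) \<and>
     (\<forall>f e. 0 < e \<longrightarrow> (\<exists>n a. C n f \<subseteq> mcball a e))"

definition suslin_set :: "'b measure \<Rightarrow> ('b \<times> 'a) set \<Rightarrow> bool" where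
  "suslin_set W E \<longleftrightarrow>
     (\<exists>A C. suslin_scheme W A C \<and> E = {(x, y). \<exists>f. \<forall>n. x \<in> A n f \<and> y \<in> C n f})"

lemma suslin_schemeD:
  assumes "suslin_scheme W A C"
  shows "A n f \<in> sets W" "closedin mtopology (C n f)"
    "(\<And>i. i < n \<Longrightarrow> f i = g i) \<Longrightarrow> A n f = A n g"
    "(\<And>i. i < n \<Longrightarrow> f i = g i) \<Longrightarrow> C n f = C n g"
    "0 < e \<Longrightarrow> \<exists>n a. C n f \<subseteq> mcball a e"
  using assms unfolding suslin_scheme_def by blast+

text \<open>When countably many branches are interleaved into one, the first \<open>m\<close>
  entries of the \<open>j\<close>-th branch sit below position \<open>prod_encode (j, m)\<close>; a
  level may therefore depend on them.\<close>

lemma prod_encode_strict_mono: "i < m \<Longrightarrow> prod_encode (j, i) < prod_encode (j, m)"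
proof (induction m)
  case (Suc m)
  have "prod_encode (j, m) < prod_encode (j, Suc m)"
    by (simp add: prod_encode_def)
  with Suc show ?case by (metis less_Suc_eq less_trans)
qed simp

lemma suslin_set_choice:
  assumes "\<And>j::nat. suslin_set W (E j)"
  obtains A C where "\<And>j. suslin_scheme W (A j) (C j)"
    "\<And>j. E j = {(x, y). \<exists>f. \<forall>n. x \<in> A j n f \<and> y \<in> C j n f}"
proof -
  let ?P = "\<lambda>j p. suslin_scheme W (fst p) (snd p) \<and>
    E j = {(x, y). \<exists>f. \<forall>n. x \<in> fst p n f \<and> y \<in> snd p n f}"
  have "\<forall>j. \<exists>p. ?P j p"
  proof
    fix j
    obtain A C where "suslin_scheme W A C" "E j = {(x, y). \<exists>f. \<forall>n. x \<in> A n f \<and> y \<in> C n f}"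
      using assms[of j] unfolding suslin_set_def by blast
    then show "\<exists>p. ?P j p" by (intro exI[of _ "(A, C)"]) simp
  qed
  then obtain p where "\<forall>j. ?P j (p j)" by (rule choice[THEN exE])
  then show thesis by (intro that[of "\<lambda>j. fst (p j)" "\<lambda>j. snd (p j)"]) blast+
qed

text \<open>One branch codes a whole sequence of branches: its \<open>j\<close>-th slice witnesses
  membership in \<open>E j\<close>, and level \<open>prod_encode (j, m)\<close> tests level
  \<open>m\<close> of that slice.\<close>

lemma suslin_set_INT:
  assumes "\<And>j::nat. suslin_set W (E j)"
  shows "suslin_set W (\<Inter>j. E j)"
proof -
  obtain A C where AC: "\<And>j. suslin_scheme W (A j) (C j)"
    and E: "\<And>j. E j = {(x, y). \<exists>f. \<forall>n. x \<in> A j n f \<and> y \<in> C j n f}"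
    using suslin_set_choice[of W E] assms by blast
  let ?sl = "\<lambda>f j i. f (prod_encode (j, i))"
  define A' where "A' n f = (case prod_decode n of (j, m) \<Rightarrow> A j m (?sl f j))" for n f
  define C' where "C' n f = (case prod_decode n of (j, m) \<Rightarrow> C j m (?sl f j))" for n f
  have dep: "A' n f = A' n g \<and> C' n f = C' n g" if "\<forall>i<n. f i = g i" for n f g
  proof -
    obtain j m where jm: "prod_decode n = (j, m)" by fastforce
    then have n: "n = prod_encode (j, m)" by (metis prod_decode_inverse)
    have eq: "?sl f j i = ?sl g j i" if "i < m" for i
      using \<open>\<forall>i<n. f i = g i\<close> prod_encode_strict_mono[OF that] n by auto
    have "A j m (?sl f j) = A j m (?sl g j)" "C j m (?sl f j) = C j m (?sl g j)"
      by (rule suslin_schemeD(3)[OF AC], fact eq) (rule suslin_schemeD(4)[OF AC], fact eq)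
    then show ?thesis unfolding A'_def C'_def jm by simp
  qed
  have small: "\<exists>n a. C' n f \<subseteq> mcball a e" if "0 < e" for f e
  proof -
    obtain n a where "C 0 n (?sl f 0) \<subseteq> mcball a e"
      using suslin_schemeD(5)[OF AC \<open>0 < e\<close>] by blast
    then have "C' (prod_encode (0, n)) f \<subseteq> mcball a e" by (simp add: C'_def)
    then show ?thesis by blast
  qed
  have "suslin_scheme W A' C'"
    unfolding suslin_scheme_def using dep small suslin_schemeD(1,2)[OF AC]
    by (auto simp: A'_def C'_def split: prod.splits)
  moreover have "(\<Inter>j. E j) = {(x, y). \<exists>f. \<forall>n. x \<in> A' n f \<and> y \<in> C' n f}" (is "_ = ?R")
  proof (rule Set.set_eqI, rule iffI)
    fix p assume "p \<in> (\<Inter>j. E j)"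
    then obtain x y where p: "p = (x, y)" and "\<forall>j. \<exists>f. \<forall>n. x \<in> A j n f \<and> y \<in> C j n f"
      unfolding E by (cases p) auto
    then obtain F where F: "\<And>j n. x \<in> A j n (F j) \<and> y \<in> C j n (F j)" by metis
    define f where "f k = (case prod_decode k of (j, i) \<Rightarrow> F j i)" for k
    have "?sl f j = F j" for j by (simp add: f_def)
    then have "\<forall>n. x \<in> A' n f \<and> y \<in> C' n f"
      using F unfolding A'_def C'_def by (auto split: prod.splits)
    then show "p \<in> ?R" using p by blast
  next
    fix p assume "p \<in> ?R"
    then obtain x y f where p: "p = (x, y)" and f: "\<And>n. x \<in> A' n f \<and> y \<in> C' n f" by auto
    have "x \<in> A j m (?sl f j) \<and> y \<in> C j m (?sl f j)" for j m
      using f[of "prod_encode (j, m)"] by (simp add: A'_def C'_def)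
    then show "p \<in> (\<Inter>j. E j)" unfolding E p by blast
  qed
  ultimately show ?thesis unfolding suslin_set_def by blast
qed

text \<open>The first entry of a branch selects the index \<open>j\<close>, the rest is a branch for
  \<open>E j\<close>. Level 0 must not depend on the branch, hence the whole spaces there.\<close>

lemma suslin_set_UN:
  assumes "\<And>j::nat. suslin_set W (E j)"
  shows "suslin_set W (\<Union>j. E j)"
proof -
  obtain A C where AC: "\<And>j. suslin_scheme W (A j) (C j)"
    and E: "\<And>j. E j = {(x, y). \<exists>f. \<forall>n. x \<in> A j n f \<and> y \<in> C j n f}"
    using suslin_set_choice[of W E] assms by blast
  define A' where "A' n f = (case n of 0 \<Rightarrow> space W | Suc m \<Rightarrow> A (f 0) m (\<lambda>i. f (Suc i)))" for n f
  define C' where "C' n f = (case n of 0 \<Rightarrow> M | Suc m \<Rightarrow> C (f 0) m (\<lambda>i. f (Suc i)))" for n f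
  have dep: "A' n f = A' n g \<and> C' n f = C' n g" if "\<forall>i<n. f i = g i" for n f g
  proof (cases n)
    case (Suc m)
    then have "f 0 = g 0" "\<And>i. i < m \<Longrightarrow> f (Suc i) = g (Suc i)" using that by auto
    then have "A (f 0) m (\<lambda>i. f (Suc i)) = A (f 0) m (\<lambda>i. g (Suc i))"
      "C (f 0) m (\<lambda>i. f (Suc i)) = C (f 0) m (\<lambda>i. g (Suc i))"
      by (intro suslin_schemeD(3,4)[OF AC]; simp)+
    then show ?thesis using \<open>f 0 = g 0\<close> unfolding A'_def C'_def Suc by simp
  qed (simp add: A'_def C'_def)
  have small: "\<exists>n a. C' n f \<subseteq> mcball a e" if "0 < e" for f e
  proof -
    obtain n a where "C (f 0) n (\<lambda>i. f (Suc i)) \<subseteq> mcball a e"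
      using suslin_schemeD(5)[OF AC \<open>0 < e\<close>] by blast
    then have "C' (Suc n) f \<subseteq> mcball a e" by (simp add: C'_def)
    then show ?thesis by blast
  qed
  have "suslin_scheme W A' C'"
    unfolding suslin_scheme_def using dep small suslin_schemeD(1,2)[OF AC]
    by (auto simp: A'_def C'_def split: nat.splits)
  moreover have "(\<Union>j. E j) = {(x, y). \<exists>f. \<forall>n. x \<in> A' n f \<and> y \<in> C' n f}" (is "_ = ?R")
  proof (rule Set.set_eqI, rule iffI)
    fix p assume "p \<in> (\<Union>j. E j)"
    then obtain x y j f where p: "p = (x, y)" and f: "\<And>n. x \<in> A j n f \<and> y \<in> C j n f"
      unfolding E by auto
    have "x \<in> space W"
      using f[of 0] sets.sets_into_space[OF suslin_schemeD(1)[OF AC]] by blast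
    moreover have "y \<in> topspace mtopology"
      using f[of 0] closedin_subset[OF suslin_schemeD(2)[OF AC]] by blast
    ultimately have "x \<in> space W" "y \<in> M" by simp_all
    then have "\<forall>n. x \<in> A' n (case_nat j f) \<and> y \<in> C' n (case_nat j f)"
      using f by (auto simp: A'_def C'_def split: nat.splits)
    then show "p \<in> ?R" using p by blast
  next
    fix p assume "p \<in> ?R"
    then obtain x y f where p: "p = (x, y)" and f: "\<And>n. x \<in> A' n f \<and> y \<in> C' n f" by auto
    have "x \<in> A (f 0) m (\<lambda>i. f (Suc i)) \<and> y \<in> C (f 0) m (\<lambda>i. f (Suc i))" for m
      using f[of "Suc m"] by (simp add: A'_def C'_def)
    then show "p \<in> (\<Union>j. E j)" unfolding E p by blast
  qed
  ultimately show ?thesis unfolding suslin_set_def by blast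
qed

lemma suslin_set_Un: "suslin_set W E \<Longrightarrow> suslin_set W F \<Longrightarrow> suslin_set W (E \<union> F)"
proof -
  assume "suslin_set W E" "suslin_set W F"
  then have "suslin_set W (\<Union>n::nat. if n = 0 then E else F)"
    by (intro suslin_set_UN) simp
  moreover have "(\<Union>n. if n = (0::nat) then E else F) = E \<union> F"
    by (auto split: if_splits)
  ultimately show ?thesis by simp
qed

text \<open>The closed factor has to shrink along branches, so a branch names centres from a
  countable dense set for balls of radius \<open>1 / Suc m\<close>. Every point lies in such balls,
  so nothing of \<open>C\<close> is lost.\<close>

lemma suslin_set_closed_rectangle:
  assumes "separable_space mtopology" "A \<in> sets W" "closedin mtopology C"
  shows "suslin_set W (A \<times> C)"
proof -
  obtain D where D: "countable D" "D \<subseteq> M" "Abstract_Topology.closure_of mtopology D = M"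
    using assms(1) unfolding separable_space_def by auto
  define q where "q = from_nat_into D"
  have dense: "\<exists>i. y \<in> mcball (q i) e" if "y \<in> M" "0 < e" for y e
  proof -
    have "y \<in> Abstract_Topology.closure_of mtopology D" using that D(3) by simp
    then obtain z where z: "z \<in> D" "d y z < e"
      using \<open>0 < e\<close> unfolding metric_closure_of by (simp add: in_mball) blast
    then have "y \<in> mcball z e" using that D(2) by (auto simp: commute)
    moreover obtain i where "z = q i" using from_nat_into_surj[OF D(1) z(1)] unfolding q_def by auto
    ultimately show ?thesis by blast
  qed
  define C' where "C' n f = (case n of 0 \<Rightarrow> C | Suc m \<Rightarrow> mcball (q (f m)) (1 / real (Suc m)))"
    for n and f :: "nat \<Rightarrow> nat"
  have small: "\<exists>n a. C' n f \<subseteq> mcball a e" if e: "0 < e" for f e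
  proof -
    obtain m where "1 / real (Suc m) < e" using nat_approx_posE[OF e] by blast
    then have "C' (Suc m) f \<subseteq> mcball (q (f m)) e"
      by (auto simp: C'_def)
    then show ?thesis by blast
  qed
  have "suslin_scheme W (\<lambda>n f. A) C'"
    unfolding suslin_scheme_def using small assms by (auto simp: C'_def split: nat.splits)
  moreover have "A \<times> C = {(x, y). \<exists>f. \<forall>n. x \<in> A \<and> y \<in> C' n f}"
  proof -
    have "\<exists>f. \<forall>n. x \<in> A \<and> y \<in> C' n f" if xy: "x \<in> A" "y \<in> C" for x y
    proof -
      have "y \<in> M" using closedin_subset[OF assms(3)] xy by auto
      then have "\<forall>m. \<exists>i. y \<in> mcball (q i) (1 / real (Suc m))" using dense by simp
      then obtain f where "\<And>m. y \<in> mcball (q (f m)) (1 / real (Suc m))" by metis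
      then have "\<forall>n. x \<in> A \<and> y \<in> C' n f" using xy by (auto simp: C'_def split: nat.splits)
      then show ?thesis by blast
    qed
    moreover have "x \<in> A \<and> y \<in> C" if "\<forall>n. x \<in> A \<and> y \<in> C' n f" for x y f
    using spec[OF that, of 0] by (simp add: C'_def)
    ultimately show ?thesis by blast
  qed
  ultimately show ?thesis unfolding suslin_set_def by blast
qed

text \<open>Suslin sets are closed under countable unions and intersections but not under
  complements, so both inductions carry the complement along. They start from closed sets and from
  open sets, which are countable unions of closed ones.\<close>

lemma suslin_set_borel:
  assumes sep: "separable_space mtopology"
    and N: "space N = M" "sets N = sigma_sets M {U. openin mtopology U}"
    and E: "E \<in> sets (W \<Otimes>\<^sub>M N)"
  shows "suslin_set W E"
proof -
  have rect: "suslin_set W (A \<times> B) \<and> suslin_set W (A \<times> (M - B))"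
    if A: "A \<in> sets W" and B: "B \<in> sets N" for A B
    using B unfolding N
  proof (induction B rule: sigma_sets.induct)
    case (Basic U)
    then have U: "openin mtopology U" by simp
    obtain C where C: "\<And>n::nat. closedin mtopology (C n)" "U = \<Union> (range C)"
      using open_imp_fsigma_in[OF metrizable_space_mtopology U] unfolding fsigma_in_ascending by blast
    have "suslin_set W (\<Union>n. A \<times> C n)"
      by (intro suslin_set_UN suslin_set_closed_rectangle sep A C)
    moreover have "closedin mtopology (M - U)" using U by (metis openin_closedin_eq topspace_mtopology)
    moreover have "A \<times> U = (\<Union>n. A \<times> C n)" unfolding C(2) by blast
    ultimately show ?case
      using suslin_set_closed_rectangle[OF sep A] by simp
  next
    case Empty
    have "M = topspace mtopology" by simp
    then show ?case
      using suslin_set_closed_rectangle[OF sep A, of "{}"] suslin_set_closed_rectangle[OF sep A, of M]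
        closedin_topspace[of mtopology] by simp
  next
    case (Compl B)
    have "{U. openin mtopology U} \<subseteq> Pow M" using openin_subset[of mtopology] by auto
    then have "B \<subseteq> M" using Compl.hyps by (rule sigma_sets_into_sp)
    then have "M - (M - B) = B" by auto
    then show ?case using Compl.IH by simp
  next
    case (Union B)
    have 1: "A \<times> \<Union> (range B) = (\<Union>n. A \<times> B n)" by auto
    have 2: "A \<times> (M - \<Union> (range B)) = (\<Inter>n. A \<times> (M - B n))" by auto
    show ?case unfolding 1 2 using Union.IH by (intro conjI suslin_set_UN suslin_set_INT) auto
  qed
  have "suslin_set W E \<and> suslin_set W (space W \<times> space N - E)"
    using E unfolding sets_pair_measure
  proof (induction E rule: sigma_sets.induct)
    case (Basic R)
    then obtain A B where AB: "R = A \<times> B" "A \<in> sets W" "B \<in> sets N" by auto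
    have "space W \<times> space N - A \<times> B = (space W - A) \<times> space N \<union> space W \<times> (M - B)"
      using N by auto
    then show ?case using AB rect by (auto intro!: suslin_set_Un)
  next
    case Empty
    show ?case using rect[of "{}" "{}"] rect[of "space W" "space N"] by auto
  next
    case (Compl F)
    have "F \<subseteq> space W \<times> space N"
      using Compl.hyps sets.sets_into_space[of F "W \<Otimes>\<^sub>M N"]
      unfolding sets_pair_measure space_pair_measure by blast
    then have "space W \<times> space N - (space W \<times> space N - F) = F" by auto
    then show ?case using Compl.IH by simp
  next
    case (Union F)
    have "space W \<times> space N - \<Union> (range F) = (\<Inter>n. space W \<times> space N - F n)" by auto
    moreover have "suslin_set W (\<Inter>n. space W \<times> space N - F n)"
      using Union.IH by (intro suslin_set_INT) blast
    ultimately show ?case using Union.IH suslin_set_UN[of W F] by simp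
  qed
  then show ?thesis ..
qed

text \<open>Successive bounds \<open>k n\<close> on the entries of the branch keep the outer measure
  of the projection above \<open>c\<close>. The tree of bounded branches is finitely branching, so
  its finite stages \<open>L n\<close> are measurable, and Koenig's lemma with completeness shows
  that their intersection lies in the projection.\<close>

lemma suslin_set_inner_projection:
  assumes "mcomplete" "finite_measure W" "suslin_set W E"
    and pos: "0 < outer_measure_of W (fst ` E)"
  shows "\<exists>S\<in>sets W. S \<subseteq> fst ` E \<and> 0 < emeasure W S"
proof -
  interpret W: finite_measure W by fact
  from assms(3) obtain A C where AC: "suslin_scheme W A C"
    and E: "E = {(x, y). \<exists>f. \<forall>n. x \<in> A n f \<and> y \<in> C n f}"
    unfolding suslin_set_def by blast
  note AC1 = suslin_schemeD(1)[OF AC] and AC2 = suslin_schemeD(2)[OF AC]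
    and AC3 = suslin_schemeD(3)[OF AC] and AC4 = suslin_schemeD(4)[OF AC]
  \<comment> \<open>\<open>D F\<close> is the projection of the part of \<open>E\<close> witnessed
    by branches in \<open>F\<close>; it need not be measurable.\<close>
  define D where "D F = {x. \<exists>f\<in>F. \<exists>y. \<forall>n. x \<in> A n f \<and> y \<in> C n f}" for F
  have DE: "D UNIV = fst ` E" unfolding D_def E by force
  have Dsub: "D F \<subseteq> space W" for F
    unfolding D_def using sets.sets_into_space[OF AC1] by blast
  obtain c where c: "0 < c" "c < outer_measure_of W (D UNIV)"
    using dense[OF pos] unfolding DE by blast
  have "\<exists>F. \<forall>n. (c < outer_measure_of W (D (F n))) \<and> (\<exists>j. F (Suc n) = F n \<inter> {f. f n \<le> j}) \<and>
      (n = 0 \<longrightarrow> F n = UNIV)"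
  proof -
    have step: "\<exists>F'. (c < outer_measure_of W (D F') \<and> (Suc n = 0 \<longrightarrow> F' = UNIV)) \<and>
        (\<exists>j. F' = F \<inter> {f. f n \<le> j})"
      if "c < outer_measure_of W (D F)" for F and n :: nat
    proof -
      \<comment> \<open>Outer measure is continuous along increasing unions of arbitrary sets, so
        some bound on the next entry still leaves more than \<open>c\<close>.\<close>
      have "incseq (\<lambda>j. D (F \<inter> {f. f n \<le> j}))"
        unfolding D_def by (intro monoI subsetI) (auto intro: order_trans)
      moreover have "D F = (\<Union>j. D (F \<inter> {f. f n \<le> j}))"
        unfolding D_def by (auto intro: order_refl)
      ultimately have "outer_measure_of W (D F) = (SUP j. outer_measure_of W (D (F \<inter> {f. f n \<le> j})))"
        using SUP_outer_measure_of_incseq[of "\<lambda>j. D (F \<inter> {f. f n \<le> j})" W] Dsub by auto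
      then have "c < (SUP j. outer_measure_of W (D (F \<inter> {f. f n \<le> j})))" using that by simp
      then obtain j where "c < outer_measure_of W (D (F \<inter> {f. f n \<le> j}))"
        unfolding less_SUP_iff by blast
      then show ?thesis by blast
    qed
    have "\<exists>F. \<forall>n. (c < outer_measure_of W (D (F n)) \<and> (n = 0 \<longrightarrow> F n = UNIV)) \<and>
        (\<exists>j. F (Suc n) = F n \<inter> {f. f n \<le> j})"
      by (rule dependent_nat_choice) (use c step in auto)
    then show ?thesis by blast
  qed
  then obtain F where F: "\<And>n. c < outer_measure_of W (D (F n))"
      "\<And>n. \<exists>j. F (Suc n) = F n \<inter> {f. f n \<le> j}" and F0: "F 0 = UNIV"
    by metis
  from F(2) obtain k where k: "\<And>n. F (Suc n) = F n \<inter> {f. f n \<le> k n}" by metis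
  have F_eq: "F n = {f. \<forall>i<n. f i \<le> k i}" for n
    by (induction n) (auto simp: F0 k less_Suc_eq)
  \<comment> \<open>Only the finite intersection of closed sets has to be nonempty; \<open>y\<close>
    may change with \<open>n\<close>, and completeness supplies a common point at the end.\<close>
  define good where "good n f x \<longleftrightarrow> (\<forall>m\<le>n. x \<in> A m f) \<and> (\<exists>y. \<forall>m\<le>n. y \<in> C m f)" for n f x
  have good_cong: "good n f x = good n g x" if "\<And>i. i < n \<Longrightarrow> f i = g i" for n f g x
  proof -
    have "A m f = A m g \<and> C m f = C m g" if "m \<le> n" for m
      using that \<open>\<And>i. i < n \<Longrightarrow> f i = g i\<close> by (intro conjI AC3 AC4) auto
    then show ?thesis unfolding good_def by auto
  qed
  define L where "L n = {x. \<exists>f\<in>F n. good n f x}" for n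
  \<comment> \<open>Finitely many representatives: \<open>good n\<close> sees only the first
    \<open>n\<close> entries, so later ones may be set to 0. The sum is merely a common bound for
    all \<open>k i\<close> with \<open>i < n\<close>.\<close>
  define T where "T n = {f. \<forall>i. (i \<in> {..<n} \<longrightarrow> f i \<in> {..\<Sum>i<n. k i}) \<and> (i \<notin> {..<n} \<longrightarrow> f i = 0)}" for n
  have finT: "finite (T n)" for n
    unfolding T_def by (rule finite_set_of_finite_funs) auto
  have L_meas: "L n \<in> sets W" for n
  proof -
    have "L n = (\<Union>g\<in>T n \<inter> F n. {x. good n g x})"
    proof (rule Set.set_eqI, rule iffI)
      fix x assume "x \<in> L n"
      then obtain f where f: "f \<in> F n" "good n f x" unfolding L_def by blast
      define g where "g i = (if i < n then f i else 0)" for i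
      have "f i \<le> (\<Sum>i<n. k i)" if "i < n" for i
      proof -
        have "k i \<le> (\<Sum>i<n. k i)" using that by (intro member_le_sum) auto
        then show ?thesis using f(1) that unfolding F_eq by (auto intro: order_trans)
      qed
      then have "g \<in> T n \<inter> F n" using f(1) unfolding T_def F_eq g_def by auto
      moreover have "good n g x" using good_cong[of n f g x] f(2) by (simp add: g_def)
      ultimately show "x \<in> (\<Union>g\<in>T n \<inter> F n. {x. good n g x})" by blast
    qed (auto simp: L_def)
    moreover have "{x. good n g x} \<in> sets W" for g
    proof (cases "\<exists>y. \<forall>m\<le>n. y \<in> C m g")
      case True
      then have "{x. good n g x} = (\<Inter>m\<in>{..n}. A m g)" unfolding good_def by auto
      then show ?thesis using AC1 by auto
    next
      case False
      then have "{x. good n g x} = {}" unfolding good_def by auto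
      then show ?thesis by simp
    qed
    ultimately show ?thesis using finT by (auto intro!: sets.finite_UN)
  qed
  have L_dec: "decseq L"
  proof (rule decseq_SucI, rule subsetI)
    fix n x assume "x \<in> L (Suc n)"
    then obtain f where "f \<in> F (Suc n)" "good (Suc n) f x" unfolding L_def by blast
    moreover from this have "good n f x" unfolding good_def by (meson le_SucI)
    ultimately show "x \<in> L n" unfolding L_def k by blast
  qed
  have "c \<le> emeasure W (\<Inter>n. L n)"
  proof -
    have "c \<le> emeasure W (L n)" for n
    proof -
      have "D (F n) \<subseteq> L n" unfolding D_def L_def good_def by blast
      then have "outer_measure_of W (D (F n)) \<le> emeasure W (L n)"
        using outer_measure_of_mono[of "D (F n)" "L n" W] L_meas by simp
      then show ?thesis using F(1)[of n] by auto
    qed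
    then have "c \<le> (INF n. emeasure W (L n))" by (rule INF_greatest)
    also have "\<dots> = emeasure W (\<Inter>n. L n)"
      by (rule INF_emeasure_decseq) (use L_meas L_dec in auto)
    finally show ?thesis .
  qed
  moreover have "(\<Inter>n. L n) \<subseteq> fst ` E"
  proof
    fix x assume x: "x \<in> (\<Inter>n. L n)"
    \<comment> \<open>Koenig's lemma: entries are fixed one at a time so that good bounded branches
      of every level \<open>N\<close> survive.\<close>
    have "\<exists>G. \<forall>n. ((\<forall>N. \<exists>g\<in>G n \<inter> F N. good N g x) \<and> (n = 0 \<longrightarrow> G n = UNIV)) \<and>
        (\<exists>j. G (Suc n) = G n \<inter> {f. f n = j})"
    proof (rule dependent_nat_choice)
      show "\<exists>G. (\<forall>N. \<exists>g\<in>G \<inter> F N. good N g x) \<and> ((0::nat) = 0 \<longrightarrow> G = UNIV)"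
        using x unfolding L_def by auto
    next
      fix G and n :: nat
      assume G: "(\<forall>N. \<exists>g\<in>G \<inter> F N. good N g x) \<and> (n = 0 \<longrightarrow> G = UNIV)"
      have "\<exists>j\<le>k n. \<forall>N. \<exists>g\<in>G \<inter> {f. f n = j} \<inter> F N. good N g x"
      proof (rule ccontr)
        assume "\<not> ?thesis"
        then obtain b where b: "\<And>j. j \<le> k n \<Longrightarrow> \<not> (\<exists>g\<in>G \<inter> {f. f n = j} \<inter> F (b j). good (b j) g x)"
          by metis
        \<comment> \<open>\<open>N\<close> exceeds every level \<open>b j\<close> at which a value
          \<open>j\<close> fails, so a branch good up to \<open>N\<close> contradicts the failure of
          its own entry; \<open>Suc n\<close> ensures that this entry is bounded by
          \<open>k n\<close>.\<close>
        define N where "N = Suc n + (\<Sum>j\<le>k n. b j)"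
        obtain g where g: "g \<in> G" "g \<in> F N" "good N g x" using G by blast
        have gk: "g n \<le> k n" using g(2) unfolding F_eq N_def by auto
        have "b (g n) \<le> (\<Sum>j\<le>k n. b j)" using gk by (intro member_le_sum) auto
        then have "b (g n) \<le> N" unfolding N_def by simp
        then have "g \<in> F (b (g n))" "good (b (g n)) g x"
          using g unfolding F_eq good_def by (auto intro: order_trans dest: less_le_trans) (meson order_trans)
        then show False using b[OF gk] g(1) by auto
      qed
      then show "\<exists>G'. ((\<forall>N. \<exists>g\<in>G' \<inter> F N. good N g x) \<and> (Suc n = 0 \<longrightarrow> G' = UNIV)) \<and>
          (\<exists>j. G' = G \<inter> {f. f n = j})"
        by blast
    qed
    then obtain G where G: "\<And>n N. \<exists>g\<in>G n \<inter> F N. good N g x"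
        "\<And>n. \<exists>j. G (Suc n) = G n \<inter> {f. f n = j}" and G0: "G 0 = UNIV"
      by metis
    from G(2) obtain f where f: "\<And>n. G (Suc n) = G n \<inter> {g. g n = f n}" by metis
    have G_eq: "G n = {g. \<forall>i<n. g i = f i}" for n
      by (induction n) (auto simp: G0 f less_Suc_eq)
    have good: "good n f x" for n
    proof -
      obtain g where g: "g \<in> G n" "good n g x" using G(1)[of n n] by blast
      have "f i = g i" if "i < n" for i using g(1) that unfolding G_eq by simp
      from good_cong[OF this] g(2) show ?thesis by simp
    qed
    \<comment> \<open>Finite intersections make the closed sets nested, as Cantor's intersection
      theorem requires.\<close>
    define C' where "C' n = (\<Inter>m\<in>{..n}. C m f)" for n
    have "\<Inter> (range C') \<noteq> {}"
    proof (rule assms(1)[unfolded mcomplete_nest, rule_format], intro conjI allI impI)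
      show "closedin mtopology (C' n)" for n
        unfolding C'_def by (intro closedin_Inter) (use AC2 in auto)
      show "C' n \<noteq> {}" for n using good[of n] unfolding good_def C'_def by auto
      show "decseq C'" unfolding C'_def by (intro decseq_SucI) auto
      show "\<exists>n a. C' n \<subseteq> mcball a e" if "0 < e" for e
        using suslin_schemeD(5)[OF AC that, of f] unfolding C'_def by blast
    qed
    then obtain y where "\<forall>n. y \<in> C n f" unfolding C'_def by blast
    moreover have "\<forall>n. x \<in> A n f" using good unfolding good_def by blast
    ultimately show "x \<in> fst ` E" unfolding E by force
  qed
  ultimately show ?thesis using c(1) L_meas by (intro bexI[of _ "\<Inter>n. L n"]) auto
qed

end

text \<open>The hypothesis says that the projection has inner measure zero. A positive outer measure
  would force a measurable subset of positive measure, so the outer measure vanishes as well and is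
  attained by a measurable cover.\<close>

lemma null_projection:
  assumes "finite_measure W" "standard_borel N" "E \<in> sets (W \<Otimes>\<^sub>M N)"
    and null: "\<And>S. S \<in> sets W \<Longrightarrow> S \<subseteq> fst ` E \<Longrightarrow> emeasure W S = 0"
  shows "\<exists>Z\<in>null_sets W. fst ` E \<subseteq> Z"
proof -
  obtain T where T: "completely_metrizable_space T" "second_countable T" "topspace T = space N"
      "sets N = sigma_sets (topspace T) {U. openin T U}"
    using assms(2) unfolding standard_borel_def by blast
  then obtain X d where Xd: "Metric_space X d" "Metric_space.mcomplete X d"
      "T = Metric_space.mtopology X d"
    unfolding completely_metrizable_space_def by blast
  interpret Metric_space X d by fact
  have "separable_space mtopology"
    using T(2) Xd(3) second_countable_imp_separable_space by auto
  moreover have "space N = X" using T(3) Xd(3) by simp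
  moreover have "sets N = sigma_sets X {U. openin mtopology U}" using T(4) Xd(3) by simp
  ultimately have "suslin_set W E"
    using assms(3) by (rule suslin_set_borel)
  then have "outer_measure_of W (fst ` E) = 0"
    using suslin_set_inner_projection[OF Xd(2) assms(1)] null
    by (metis linorder_neqE not_less_zero)
  moreover have "fst ` E \<subseteq> space W"
    using sets.sets_into_space[OF assms(3)] by (auto simp: space_pair_measure)
  ultimately show ?thesis
    using outer_measure_of_attain[of "fst ` E" W] by (metis null_setsI)
qed

subsection \<open>Borel partial injections as relations\<close>

text \<open>Off the diagonal, Hausdorff separation puts each pair into a product of two disjoint
  members of a countable base.\<close>

lemma standard_borel_Id_on:
  assumes "standard_borel M"
  shows "Id_on (space M) \<in> sets (M \<Otimes>\<^sub>M M)"
proof -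
  obtain T where T: "completely_metrizable_space T" "second_countable T" "topspace T = space M"
      "sets M = sigma_sets (topspace T) {U. openin T U}"
    using assms unfolding standard_borel_def by blast
  then have "Hausdorff_space T"
    using completely_metrizable_imp_metrizable_space metrizable_imp_Hausdorff_space by blast
  obtain B where B: "countable B" "\<And>V. V \<in> B \<Longrightarrow> openin T V"
      "\<And>U x. openin T U \<Longrightarrow> x \<in> U \<Longrightarrow> \<exists>V\<in>B. x \<in> V \<and> V \<subseteq> U"
    using T(2) unfolding second_countable_def by metis
  have B_sets: "V \<in> sets M" if "V \<in> B" for V
    using B(2)[OF that] T(4) by auto
  let ?D = "\<Union>V\<in>B. \<Union>W\<in>{W \<in> B. V \<inter> W = {}}. V \<times> W"
  have "?D \<in> sets (M \<Otimes>\<^sub>M M)"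
    using B(1) B_sets by (intro sets.countable_UN' countable_Collect) auto
  moreover have "Id_on (space M) = space (M \<Otimes>\<^sub>M M) - ?D"
  proof (intro equalityI subsetI)
    fix p assume p: "p \<in> space (M \<Otimes>\<^sub>M M) - ?D"
    obtain x y where xy: "p = (x, y)" "x \<in> space M" "y \<in> space M"
      using p by (auto simp: space_pair_measure)
    have "x = y"
    proof (rule ccontr)
      assume "x \<noteq> y"
      then obtain U V where UV: "openin T U" "openin T V" "x \<in> U" "y \<in> V" "disjnt U V"
        using \<open>Hausdorff_space T\<close> xy T(3) unfolding Hausdorff_space_def by metis
      obtain U' where U': "U' \<in> B" "x \<in> U'" "U' \<subseteq> U" using B(3)[OF UV(1,3)] by blast
      obtain V' where V': "V' \<in> B" "y \<in> V'" "V' \<subseteq> V" using B(3)[OF UV(2,4)] by blast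
      have "U' \<inter> V' = {}" using UV(5) U'(3) V'(3) unfolding disjnt_def by blast
      then have "p \<in> ?D" using U' V' unfolding xy(1) by blast
      then show False using p by blast
    qed
    then show "p \<in> Id_on (space M)" using xy by auto
  qed (auto simp: space_pair_measure)
  ultimately show ?thesis by simp
qed

text \<open>Relations carry their domain with them, so inverse, composition and restriction are
  plain set operations. Containment in \<open>R\<close> is left out because the scaling maps need
  not lie in \<open>R\<close>.\<close>

definition borel_pinj :: "'a measure \<Rightarrow> ('a \<times> 'a) set \<Rightarrow> bool" where
  "borel_pinj M G \<longleftrightarrow> G \<subseteq> space M \<times> space M \<and> single_valued G \<and> single_valued (G\<inverse>) \<and>
     (\<forall>E\<in>sets M. G `` E \<in> sets M \<and> G\<inverse> `` E \<in> sets M)"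

lemma borel_pinjD:
  assumes "borel_pinj M G"
  shows "G \<subseteq> space M \<times> space M" "(x, y) \<in> G \<Longrightarrow> (x, z) \<in> G \<Longrightarrow> y = z"
    "(x, z) \<in> G \<Longrightarrow> (y, z) \<in> G \<Longrightarrow> x = y"
    "E \<in> sets M \<Longrightarrow> G `` E \<in> sets M" "E \<in> sets M \<Longrightarrow> G\<inverse> `` E \<in> sets M"
proof -
  have G: "G \<subseteq> space M \<times> space M" "single_valued G" "single_valued (G\<inverse>)"
      "\<forall>E\<in>sets M. G `` E \<in> sets M \<and> G\<inverse> `` E \<in> sets M"
    using assms unfolding borel_pinj_def by simp_all
  show "G \<subseteq> space M \<times> space M" by fact
  show "y = z" if "(x, y) \<in> G" "(x, z) \<in> G" by (rule single_valuedD[OF G(2) that])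
  show "x = y" if "(x, z) \<in> G" "(y, z) \<in> G" by (rule single_valuedD[OF G(3)]) (use that in simp_all)
  show "G `` E \<in> sets M" "G\<inverse> `` E \<in> sets M" if "E \<in> sets M" using G(4) that by simp_all
qed

lemma borel_pinj_converse: "borel_pinj M G \<Longrightarrow> borel_pinj M (G\<inverse>)"
proof -
  assume G: "borel_pinj M G"
  then have "G\<inverse> \<subseteq> space M \<times> space M" using borel_pinjD(1)[OF G] by blast
  then show ?thesis using G unfolding borel_pinj_def by simp
qed

lemma borel_pinj_relcomp: "borel_pinj M G \<Longrightarrow> borel_pinj M H \<Longrightarrow> borel_pinj M (G O H)"
proof -
  assume G: "borel_pinj M G" and H: "borel_pinj M H"
  have "single_valued (G O H)" "single_valued ((G O H)\<inverse>)"
    using G H unfolding borel_pinj_def converse_relcomp by (simp_all add: single_valued_relcomp)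
  moreover have "(G O H) `` E \<in> sets M" "(G O H)\<inverse> `` E \<in> sets M" if "E \<in> sets M" for E
    using that borel_pinjD(4,5)[OF G] borel_pinjD(4,5)[OF H]
    by (simp_all add: converse_relcomp relcomp_Image)
  moreover have "G O H \<subseteq> space M \<times> space M"
    using borel_pinjD(1)[OF G] borel_pinjD(1)[OF H] by blast
  ultimately show ?thesis unfolding borel_pinj_def by simp
qed

lemma borel_pinj_empty: "borel_pinj M {}"
  unfolding borel_pinj_def by simp

lemma borel_pinj_Id_on: "A \<in> sets M \<Longrightarrow> borel_pinj M (Id_on A)"
proof -
  assume A: "A \<in> sets M"
  have "Id_on A `` E = A \<inter> E" for E by auto
  then show ?thesis
    unfolding borel_pinj_def using A sets.sets_into_space[OF A] by (auto simp: single_valued_def)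
qed

lemma borel_pinj_Domain: "borel_pinj M G \<Longrightarrow> Domain G \<in> sets M"
proof -
  assume G: "borel_pinj M G"
  have "Domain G = G\<inverse> `` space M" using borel_pinjD(1)[OF G] by blast
  then show ?thesis using borel_pinjD(5)[OF G] by simp
qed

lemma borel_pinj_Range: "borel_pinj M G \<Longrightarrow> Range G \<in> sets M"
  using borel_pinj_Domain[OF borel_pinj_converse] by simp

lemma borel_pinj_restrict:
  assumes G: "borel_pinj M G" and "A \<in> sets M" "B \<in> sets M"
  shows "borel_pinj M (G \<inter> A \<times> B)"
proof -
  have "G \<inter> A \<times> B = Id_on A O G O Id_on B" by auto
  then show ?thesis using assms by (simp add: borel_pinj_relcomp borel_pinj_Id_on)
qed

lemma borel_pinj_UN:
  assumes "countable I" "\<And>i. i \<in> I \<Longrightarrow> borel_pinj M (G i)"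
    "single_valued (\<Union>i\<in>I. G i)" "single_valued ((\<Union>i\<in>I. G i)\<inverse>)"
  shows "borel_pinj M (\<Union>i\<in>I. G i)"
proof -
  have "(\<Union>i\<in>I. G i) `` E = (\<Union>i\<in>I. G i `` E)" "(\<Union>i\<in>I. G i)\<inverse> `` E = (\<Union>i\<in>I. (G i)\<inverse> `` E)" for E
    by blast+
  moreover have "(\<Union>i\<in>I. G i `` E) \<in> sets M" "(\<Union>i\<in>I. (G i)\<inverse> `` E) \<in> sets M" if "E \<in> sets M" for E
    using assms(1) borel_pinjD(4,5)[OF assms(2) that] by (auto intro!: sets.countable_UN')
  moreover have "(\<Union>i\<in>I. G i) \<subseteq> space M \<times> space M" using borel_pinjD(1)[OF assms(2)] by blast
  ultimately show ?thesis using assms(3,4) unfolding borel_pinj_def by simp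
qed

lemma mem_graph_on: "(x, y) \<in> graph_on A f \<longleftrightarrow> x \<in> A \<and> y = f x"
  by (auto simp: graph_on_def)

lemma the_eq_if_single_valued: "single_valued G \<Longrightarrow> (x, y) \<in> G \<Longrightarrow> (THE y. (x, y) \<in> G) = y"
  by (auto simp: single_valued_def)

lemma bimeasurable_bij_imp_measurable_image:
  assumes f: "bimeasurable_bij M A N B f" and E: "E \<in> sets M"
  shows "graph_on A f `` E \<in> sets N"
proof -
  have AB: "A \<in> sets M" "B \<in> sets N" "bij_betw f A B"
      "the_inv_into A f \<in> restrict_space N B \<rightarrow>\<^sub>M restrict_space M A"
    using f unfolding bimeasurable_bij_def by auto
  then have inj: "inj_on f A" "f ` A = B" by (auto simp: bij_betw_def)
  have sp: "space (restrict_space N B) = B"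
    using AB(2) sets.sets_into_space by (auto simp: space_restrict_space)
  have "E \<inter> A \<in> sets (restrict_space M A)" using AB(1) E by (auto simp: sets_restrict_space)
  from measurable_sets[OF AB(4) this] have "the_inv_into A f -` (E \<inter> A) \<inter> B \<in> sets N"
    unfolding sp using AB(2) by (simp add: sets_restrict_space_iff)
  moreover have "the_inv_into A f -` (E \<inter> A) \<inter> B = graph_on A f `` E"
    unfolding graph_on_def using inj by (auto simp: the_inv_into_f_f)
  ultimately show ?thesis by simp
qed

lemma bimeasurable_bij_imp_measurable_preimage:
  assumes f: "bimeasurable_bij M A N B f" and E: "E \<in> sets N"
  shows "(graph_on A f)\<inverse> `` E \<in> sets M"
proof -
  have AB: "A \<in> sets M" "B \<in> sets N" "bij_betw f A B"
      "f \<in> restrict_space M A \<rightarrow>\<^sub>M restrict_space N B"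
    using f unfolding bimeasurable_bij_def by auto
  have sp: "space (restrict_space M A) = A"
    using AB(1) sets.sets_into_space by (auto simp: space_restrict_space)
  have "E \<inter> B \<in> sets (restrict_space N B)" using AB(2) E by (auto simp: sets_restrict_space)
  from measurable_sets[OF AB(4) this] have "f -` (E \<inter> B) \<inter> A \<in> sets M"
    unfolding sp using AB(1) by (simp add: sets_restrict_space_iff)
  moreover have "f -` (E \<inter> B) \<inter> A = (graph_on A f)\<inverse> `` E"
    using AB(3) unfolding graph_on_def by (auto simp: bij_betw_def)
  ultimately show ?thesis by simp
qed

lemma bimeasurable_bij_imp_borel_pinj:
  assumes f: "bimeasurable_bij M A M B f"
  shows "borel_pinj M (graph_on A f)"
proof -
  have "bij_betw f A B" "A \<subseteq> space M" "B \<subseteq> space M"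
    using f sets.sets_into_space unfolding bimeasurable_bij_def by auto
  then show ?thesis
    unfolding borel_pinj_def
    using bimeasurable_bij_imp_measurable_image[OF f] bimeasurable_bij_imp_measurable_preimage[OF f]
    by (auto simp: graph_on_def single_valued_def bij_betw_def inj_on_def)
qed

lemma borel_pinj_imp_bimeasurable_bij:
  assumes G: "borel_pinj M G"
  obtains f where "bimeasurable_bij M (Domain G) M (Range G) f" "G = graph_on (Domain G) f"
proof -
  define f where "f x = (THE y. (x, y) \<in> G)" for x
  have sv: "single_valued G" and svc: "single_valued (G\<inverse>)" using G unfolding borel_pinj_def by auto
  have f: "f x = y" if "(x, y) \<in> G" for x y
    unfolding f_def by (rule the_eq_if_single_valued[OF sv that])
  have graph: "G = graph_on (Domain G) f"
    unfolding graph_on_def using f by (auto simp: image_iff)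
  have inj: "inj_on f (Domain G)"
    using f borel_pinjD(3)[OF G] by (auto simp: inj_on_def)
  have img: "f ` Domain G = Range G" using f by force
  have dr: "Domain G \<in> sets M" "Range G \<in> sets M"
    using borel_pinj_Domain[OF G] borel_pinj_Range[OF G] .
  have sp: "space (restrict_space M (Domain G)) = Domain G" "space (restrict_space M (Range G)) = Range G"
    using dr sets.sets_into_space by (auto simp: space_restrict_space)
  have "f \<in> restrict_space M (Domain G) \<rightarrow>\<^sub>M restrict_space M (Range G)"
  proof (rule measurableI)
    fix E assume "E \<in> sets (restrict_space M (Range G))"
    then have E: "E \<in> sets M" "E \<subseteq> Range G" using dr by (auto simp: sets_restrict_space_iff)
    have "f -` E \<inter> Domain G = G\<inverse> `` E" using f by blast
    then show "f -` E \<inter> space (restrict_space M (Domain G)) \<in> sets (restrict_space M (Domain G))"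
      using dr borel_pinjD(5)[OF G E(1)] unfolding sp by (auto simp: sets_restrict_space_iff)
  qed (use sp img in blast)
  moreover have "the_inv_into (Domain G) f \<in> restrict_space M (Range G) \<rightarrow>\<^sub>M restrict_space M (Domain G)"
  proof (rule measurableI)
    fix E assume "E \<in> sets (restrict_space M (Domain G))"
    then have E: "E \<in> sets M" "E \<subseteq> Domain G" using dr by (auto simp: sets_restrict_space_iff)
    have "the_inv_into (Domain G) f -` E \<inter> Range G = f ` E"
    proof (intro equalityI subsetI)
      fix y assume y: "y \<in> the_inv_into (Domain G) f -` E \<inter> Range G"
      then have "f (the_inv_into (Domain G) f y) = y" using f_the_inv_into_f[OF inj] img by blast
      then show "y \<in> f ` E" using y by (metis IntD1 imageI vimageE)
    next
      fix y assume "y \<in> f ` E"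
      then obtain x where x: "x \<in> E" "y = f x" by blast
      then have "the_inv_into (Domain G) f y = x" using the_inv_into_f_f[OF inj] E(2) by blast
      then show "y \<in> the_inv_into (Domain G) f -` E \<inter> Range G" using x E(2) img by blast
    qed
    also have "\<dots> = G `` E" using f E(2) by force
    finally show "the_inv_into (Domain G) f -` E \<inter> space (restrict_space M (Range G))
        \<in> sets (restrict_space M (Range G))"
      using dr borel_pinjD(4)[OF G E(1)] unfolding sp by (auto simp: sets_restrict_space_iff)
  next
    fix y assume "y \<in> space (restrict_space M (Range G))"
    then show "the_inv_into (Domain G) f y \<in> space (restrict_space M (Domain G))"
      unfolding sp using the_inv_into_into[OF inj _ order_refl] img by blast
  qed
  ultimately have "bimeasurable_bij M (Domain G) M (Range G) f"
    unfolding bimeasurable_bij_def using dr inj img by (auto simp: bij_betw_def)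
  with graph that show thesis by blast
qed

lemma borel_pinj_iff_partial_automorphism:
  "borel_pinj M G \<and> G \<subseteq> R \<longleftrightarrow> (\<exists>A B f. partial_automorphism M R A B f \<and> G = graph_on A f)"
proof (intro iffI; elim exE conjE)
  assume G: "borel_pinj M G" "G \<subseteq> R"
  obtain f where "bimeasurable_bij M (Domain G) M (Range G) f" "G = graph_on (Domain G) f"
    using borel_pinj_imp_bimeasurable_bij[OF G(1)] .
  then have "partial_automorphism M R (Domain G) (Range G) f \<and> G = graph_on (Domain G) f"
    unfolding partial_automorphism_def using G(2) by simp
  then show "\<exists>A B f. partial_automorphism M R A B f \<and> G = graph_on A f" by blast
next
  fix A B f assume "partial_automorphism M R A B f" "G = graph_on A f"
  then show "borel_pinj M G \<and> G \<subseteq> R"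
    unfolding partial_automorphism_def using bimeasurable_bij_imp_borel_pinj by blast
qed

lemma borel_pinj_in_full_group:
  assumes "borel_pinj M G" "G \<subseteq> R" "Domain G = space M" "Range G = space M"
  shows "G \<in> symmetric_vertices M R"
proof -
  obtain f where f: "bimeasurable_bij M (Domain G) M (Range G) f" "G = graph_on (Domain G) f"
    using borel_pinj_imp_bimeasurable_bij[OF assms(1)] .
  then have "f \<in> full_group M R"
    using assms unfolding full_group_def partial_automorphism_def by simp
  then show ?thesis using f(2) assms(3) unfolding symmetric_vertices_def by simp
qed

text \<open>Pulling \<open>E\<close> back along \<open>x \<mapsto> (x, f x)\<close> gives a Borel
  set of \<open>x\<close>, so the intersection is a restriction of the domain.\<close>

lemma borel_pinj_Int:
  assumes G: "borel_pinj M G" and E: "E \<in> sets (M \<Otimes>\<^sub>M M)"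
  shows "borel_pinj M (G \<inter> E)"
proof -
  obtain f where f: "bimeasurable_bij M (Domain G) M (Range G) f" "G = graph_on (Domain G) f"
    using borel_pinj_imp_bimeasurable_bij[OF G] .
  have mem: "(x, y) \<in> G \<longleftrightarrow> x \<in> Domain G \<and> y = f x" for x y
    by (metis f(2) mem_graph_on)
  let ?D = "Domain G"
  have D: "?D \<in> sets M" by (rule borel_pinj_Domain[OF G])
  have sp: "space (restrict_space M ?D) = ?D"
    using D sets.sets_into_space by (auto simp: space_restrict_space)
  have "f \<in> restrict_space M ?D \<rightarrow>\<^sub>M M"
    using f(1) unfolding bimeasurable_bij_def by (auto simp: measurable_restrict_space2_iff)
  moreover have "(\<lambda>x. x) \<in> restrict_space M ?D \<rightarrow>\<^sub>M M"
    by (rule measurable_restrict_space1) simp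
  ultimately have "(\<lambda>x. (x, f x)) \<in> restrict_space M ?D \<rightarrow>\<^sub>M M \<Otimes>\<^sub>M M"
    by (intro measurable_Pair) simp_all
  from measurable_sets[OF this E] have "(\<lambda>x. (x, f x)) -` E \<inter> ?D \<in> sets M"
    unfolding sp using D by (simp add: sets_restrict_space_iff)
  moreover have "G \<inter> E = G \<inter> ((\<lambda>x. (x, f x)) -` E \<inter> ?D) \<times> space M"
    using mem borel_pinjD(1)[OF G] by auto
  ultimately show ?thesis using borel_pinj_restrict[OF G] by simp
qed

text \<open>The graph is the preimage of the Borel diagonal under
  \<open>(x, y) \<mapsto> (f x, y)\<close>.\<close>

lemma borel_pinj_sets:
  assumes "standard_borel M" and G: "borel_pinj M G"
  shows "G \<in> sets (M \<Otimes>\<^sub>M M)"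
proof -
  obtain f where f: "bimeasurable_bij M (Domain G) M (Range G) f" "G = graph_on (Domain G) f"
    using borel_pinj_imp_bimeasurable_bij[OF G] .
  have mem: "(x, y) \<in> G \<longleftrightarrow> x \<in> Domain G \<and> y = f x" for x y
    by (metis f(2) mem_graph_on)
  let ?D = "Domain G"
  have D: "?D \<in> sets M" by (rule borel_pinj_Domain[OF G])
  have sp: "space (restrict_space M ?D) = ?D"
    using D sets.sets_into_space by (auto simp: space_restrict_space)
  have "f \<in> restrict_space M ?D \<rightarrow>\<^sub>M M"
    using f(1) unfolding bimeasurable_bij_def by (auto simp: measurable_restrict_space2_iff)
  then have "(\<lambda>p. (f (fst p), snd p)) \<in> restrict_space M ?D \<Otimes>\<^sub>M M \<rightarrow>\<^sub>M M \<Otimes>\<^sub>M M"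
    by (intro measurable_Pair measurable_compose[OF measurable_fst] measurable_snd)
  from measurable_sets[OF this standard_borel_Id_on[OF assms(1)]]
  have "(\<lambda>p. (f (fst p), snd p)) -` Id_on (space M) \<inter> space (restrict_space M ?D \<Otimes>\<^sub>M M)
      \<in> sets (restrict_space M ?D \<Otimes>\<^sub>M M)" .
  moreover have "(\<lambda>p. (f (fst p), snd p)) -` Id_on (space M) \<inter> space (restrict_space M ?D \<Otimes>\<^sub>M M) = G"
    using mem borel_pinjD(1)[OF G] by (auto simp: space_pair_measure sp)
  ultimately have "G \<in> sets (restrict_space M ?D \<Otimes>\<^sub>M M)" by simp
  also have "\<dots> \<subseteq> sets (M \<Otimes>\<^sub>M M)"
    unfolding sets_pair_measure[of "restrict_space M ?D"]
    using D sets.sets_into_space[of _ M]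
    by (intro sets.sigma_sets_subset'[where M = "M \<Otimes>\<^sub>M M"])
      (auto simp: sp sets_restrict_space_iff)
  finally show ?thesis .
qed

text \<open>The generators constructed later may overlap, whereas \<open>finite_graphing\<close>
  asks for a partition. Each new one is cut down to what the others do not cover, and dropped if
  nothing remains.\<close>

lemma borel_pinj_partition:
  assumes "standard_borel M" "finite \<G>" "\<And>G. G \<in> \<G> \<Longrightarrow> borel_pinj M G"
  shows "\<exists>P. finite P \<and> partition_on (\<Union>\<G>) P \<and> (\<forall>G\<in>P. borel_pinj M G)"
  using assms(2,3)
proof (induction \<G> rule: finite_induct)
  case empty
  show ?case by (intro exI[of _ "{}"]) (auto simp: partition_on_def)
next
  case (insert G \<G>)
  then obtain P where P: "finite P" "partition_on (\<Union>\<G>) P" "\<forall>G\<in>P. borel_pinj M G" by auto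
  let ?H = "G - \<Union>\<G>"
  have G: "borel_pinj M G" using insert by simp
  have "\<Union>\<G> \<in> sets (M \<Otimes>\<^sub>M M)"
    using insert borel_pinj_sets[OF assms(1)] by (intro sets.finite_Union) auto
  then have "space (M \<Otimes>\<^sub>M M) - \<Union>\<G> \<in> sets (M \<Otimes>\<^sub>M M)" by simp
  from borel_pinj_Int[OF G this] have "borel_pinj M (G \<inter> (space (M \<Otimes>\<^sub>M M) - \<Union>\<G>))" .
  moreover have "G \<inter> (space (M \<Otimes>\<^sub>M M) - \<Union>\<G>) = ?H"
    using borel_pinjD(1)[OF G] by (auto simp: space_pair_measure)
  ultimately have H: "borel_pinj M ?H" by simp
  show ?case
  proof (cases "?H = {}")
    case True
    then have "\<Union>(insert G \<G>) = \<Union>\<G>" by auto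
    with P show ?thesis by auto
  next
    case False
    have UP: "\<Union>P = \<Union>\<G>" and "disjoint P" "{} \<notin> P" using P(2) by (simp_all add: partition_on_def)
    have "\<Union>(insert ?H P) = \<Union>(insert G \<G>)" using UP by blast
    moreover have "disjoint (insert ?H P)"
    proof -
      have "p \<inter> ?H = {}" if "p \<in> P" for p using that UP by blast
      then show ?thesis using \<open>disjoint P\<close> unfolding disjoint_def by (simp add: Int_commute)
    qed
    ultimately have "partition_on (\<Union>(insert G \<G>)) (insert ?H P)"
      using \<open>{} \<notin> P\<close> False unfolding partition_on_def by simp
    then show ?thesis using P H by (intro exI[of _ "insert ?H P"]) auto
  qed
qed

subsection \<open>Intermediate values of non-atomic measures\<close>

text \<open>A proper part and its complement cannot both exceed half the measure; repeated halving
  gets below \<open>e\<close>.\<close>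

lemma (in finite_measure) nonatomic_small_subset:
  assumes "nonatomic M" "A \<in> sets M" "0 < measure M A" "0 < e"
  shows "\<exists>B\<in>sets M. B \<subseteq> A \<and> 0 < measure M B \<and> measure M B < e"
proof -
  have half: "\<exists>B\<in>sets M. B \<subseteq> A \<and> 0 < measure M B \<and> measure M B \<le> measure M A / 2"
    if A: "A \<in> sets M" "0 < measure M A" for A
  proof -
    have "0 < emeasure M A" using A(2) by (simp add: emeasure_eq_measure)
    then obtain B where B: "B \<in> sets M" "B \<subseteq> A" "0 < emeasure M B" "emeasure M B < emeasure M A"
      using assms(1) A(1) unfolding nonatomic_def by blast
    have m: "0 < measure M B" "measure M B < measure M A"
      using B(3,4) by (auto simp: emeasure_eq_measure ennreal_less_iff)
    have "measure M (A - B) = measure M A - measure M B"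
      using finite_measure_Diff A B by auto
    then show ?thesis
      using m B A by (cases "measure M B \<le> measure M A / 2") (auto intro: bexI[of _ B] bexI[of _ "A - B"])
  qed
  have "\<exists>B\<in>sets M. B \<subseteq> A \<and> 0 < measure M B \<and> measure M B \<le> measure M A / 2 ^ n" for n
  proof (induction n)
    case 0
    show ?case using assms(2,3) by auto
  next
    case (Suc n)
    then obtain B where B: "B \<in> sets M" "B \<subseteq> A" "0 < measure M B" "measure M B \<le> measure M A / 2 ^ n"
      by blast
    obtain C where "C \<in> sets M" "C \<subseteq> B" "0 < measure M C" "measure M C \<le> measure M B / 2"
      using half[OF B(1,3)] by blast
    with B show ?case by (intro bexI[of _ C]) auto
  qed
  moreover obtain n where "measure M A / 2 ^ n < e"
  proof -
    have "(\<lambda>n. measure M A / 2 ^ n) \<longlonglongrightarrow> 0"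
      by (rule LIMSEQ_divide_realpow_zero) simp
    then have "\<forall>\<^sub>F n in sequentially. measure M A / 2 ^ n < e"
      using assms(4) by (rule order_tendstoD)
    then show thesis using that by (auto simp: eventually_sequentially)
  qed
  ultimately show ?thesis by (meson le_less_trans)
qed

text \<open>Greedy exhaustion: every step adds a set at least half as large as is still possible, so the
  gaps left at the end would have to be smaller than every admissible set.\<close>

lemma (in finite_measure) nonatomic_intermediate_value:
  assumes "nonatomic M" "A \<in> sets M" "0 \<le> c" "c \<le> measure M A"
  shows "\<exists>B\<in>sets M. B \<subseteq> A \<and> measure M B = c"
proof -
  define S where "S B = {measure M C |C. C \<in> sets M \<and> C \<subseteq> A - B \<and> measure M B + measure M C \<le> c}" for B
  have bdd: "bdd_above (S B)" for B
    unfolding S_def by (rule bdd_aboveI[of _ c]) (clarsimp, use measure_nonneg[of M B] in linarith)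
  let ?I = "\<lambda>B. B \<in> sets M \<and> B \<subseteq> A \<and> measure M B \<le> c"
  have "\<exists>B. \<forall>n::nat. ?I (B n) \<and>
      (\<exists>C\<in>sets M. C \<subseteq> A - B n \<and> B (Suc n) = B n \<union> C \<and> Sup (S (B n)) / 2 \<le> measure M C)"
  proof (rule dependent_nat_choice)
    show "\<exists>B. ?I B" using assms by (intro exI[of _ "{}"]) auto
  next
    fix B and n :: nat assume B: "?I B"
    have zero: "0 \<in> S B" unfolding S_def using B by (auto intro!: exI[of _ "{}"])
    have "\<exists>s\<in>S B. Sup (S B) / 2 \<le> s"
    proof (cases "Sup (S B) \<le> 0")
      case True
      then show ?thesis using zero by (intro bexI[of _ 0]) auto
    next
      case False
      then have "Sup (S B) / 2 < Sup (S B)" by simp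
      then show ?thesis using less_cSup_iff[OF _ bdd] zero by (metis empty_iff less_imp_le)
    qed
    then obtain C where C: "C \<in> sets M" "C \<subseteq> A - B" "measure M B + measure M C \<le> c"
        "Sup (S B) / 2 \<le> measure M C"
      unfolding S_def by auto
    have "measure M (B \<union> C) = measure M B + measure M C"
      using B C by (intro finite_measure_Union) auto
    then show "\<exists>B'. ?I B' \<and> (\<exists>C\<in>sets M. C \<subseteq> A - B \<and> B' = B \<union> C \<and> Sup (S B) / 2 \<le> measure M C)"
      using B C by (intro exI[of _ "B \<union> C"]) auto
  qed
  then obtain B where B: "\<And>n. ?I (B n)"
      "\<And>n. \<exists>C\<in>sets M. C \<subseteq> A - B n \<and> B (Suc n) = B n \<union> C \<and> Sup (S (B n)) / 2 \<le> measure M C"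
    by blast
  have inc: "incseq B" by (rule incseq_SucI) (use B(2) in blast)
  have step: "Sup (S (B n)) / 2 \<le> measure M (B (Suc n)) - measure M (B n)" for n
  proof -
    obtain C where C: "C \<in> sets M" "C \<subseteq> A - B n" "B (Suc n) = B n \<union> C" "Sup (S (B n)) / 2 \<le> measure M C"
      using B(2) by blast
    have "measure M (B n \<union> C) = measure M (B n) + measure M C"
      using B(1) C by (intro finite_measure_Union) auto
    with C show ?thesis by simp
  qed
  let ?U = "\<Union>n. B n"
  have U: "?U \<in> sets M" "?U \<subseteq> A" using B(1) by auto
  have lim: "(\<lambda>n. measure M (B n)) \<longlonglongrightarrow> measure M ?U"
    by (rule finite_Lim_measure_incseq) (use B(1) inc in auto)
  have le: "measure M ?U \<le> c"
    by (rule LIMSEQ_le_const2[OF lim]) (use B(1) in auto)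
  have "measure M ?U = c"
  proof (rule ccontr)
    assume "measure M ?U \<noteq> c"
    with le have lt: "measure M ?U < c" by simp
    have "measure M (A - ?U) = measure M A - measure M ?U"
      using U assms(2) by (intro finite_measure_Diff) auto
    then have "0 < measure M (A - ?U)" using lt assms(4) by simp
    then obtain C where C: "C \<in> sets M" "C \<subseteq> A - ?U" "0 < measure M C" "measure M C < c - measure M ?U"
      using nonatomic_small_subset[OF assms(1), of "A - ?U" "c - measure M ?U"] U assms(2) lt by auto
    have ge: "measure M C \<le> Sup (S (B n))" for n
    proof (rule cSup_upper[OF _ bdd])
      have "measure M (B n) \<le> measure M ?U" using U by (intro finite_measure_mono) auto
      then show "measure M C \<in> S (B n)" unfolding S_def using C by force
    qed
    \<comment> \<open>The increments of a convergent sequence tend to 0, yet each is at least half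
      the measure of \<open>C\<close>, which stays admissible forever.\<close>
    have "(\<lambda>n. measure M (B (Suc n)) - measure M (B n)) \<longlonglongrightarrow> measure M ?U - measure M ?U"
      by (intro tendsto_diff lim LIMSEQ_Suc)
    moreover have "\<forall>n\<ge>0. measure M C / 2 \<le> measure M (B (Suc n)) - measure M (B n)"
      using step ge by (meson divide_right_mono order_trans zero_le_numeral)
    ultimately have "measure M C / 2 \<le> measure M ?U - measure M ?U"
      by (intro LIMSEQ_le_const) blast+
    then show False using C(3) by simp
  qed
  then show ?thesis using U by blast
qed

subsection \<open>Partial automorphisms between sets of equal measure\<close>

lemma borel_pinj_Un:
  assumes G: "borel_pinj M G" and H: "borel_pinj M H"
    and "Domain G \<inter> Domain H = {}" "Range G \<inter> Range H = {}"
  shows "borel_pinj M (G \<union> H)"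
proof -
  have "single_valued (G \<union> H)" "single_valued ((G \<union> H)\<inverse>)"
    using assms unfolding borel_pinj_def single_valued_def by blast+
  moreover have "(G \<union> H) `` E \<in> sets M" "(G \<union> H)\<inverse> `` E \<in> sets M" if "E \<in> sets M" for E
    using borel_pinjD(4,5)[OF G that] borel_pinjD(4,5)[OF H that]
    by (simp_all add: Un_Image converse_Un)
  ultimately show ?thesis
    using borel_pinjD(1)[OF G] borel_pinjD(1)[OF H] unfolding borel_pinj_def by blast
qed

lemma borel_pinj_UN_incseq:
  assumes G: "\<And>n::nat. borel_pinj M (G n)" and "incseq G"
  shows "borel_pinj M (\<Union>n. G n)"
proof (rule borel_pinj_UN)
  have le: "G m \<subseteq> G (max m n)" "G n \<subseteq> G (max m n)" for m n
    using incseqD[OF assms(2)] by auto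
  show "single_valued (\<Union>n. G n)"
    unfolding single_valued_def using le borel_pinjD(2)[OF G] by blast
  show "single_valued ((\<Union>n. G n)\<inverse>)"
    unfolding single_valued_def using le borel_pinjD(3)[OF G] by blast
qed (use G in auto)

text \<open>A path spells a finite word in the generators, the composite of a word is again a
  partial injection, and there are only countably many words.\<close>

lemma countable_path_relations:
  assumes "countable \<G>" "\<And>G. G \<in> \<G> \<Longrightarrow> borel_pinj M G"
  shows "\<exists>W. countable W \<and> (\<forall>w\<in>W. borel_pinj M w \<and> w \<subseteq> (\<Union>\<G>)\<^sup>*) \<and>
    (\<forall>x y. x \<in> space M \<longrightarrow> (x, y) \<in> (\<Union>\<G>)\<^sup>* \<longrightarrow> (\<exists>w\<in>W. (x, y) \<in> w))"
proof -
  define c where "c gs = foldr (O) gs (Id_on (space M))" for gs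
  have c: "borel_pinj M (c gs) \<and> c gs \<subseteq> (\<Union>\<G>)\<^sup>*" if "gs \<in> lists \<G>" for gs
    using that
  proof (induction gs)
    case Nil
    show ?case by (auto simp: c_def borel_pinj_Id_on)
  next
    case (Cons g gs)
    then have "borel_pinj M g" "g \<subseteq> \<Union>\<G>" "c (g # gs) = g O c gs" using assms(2) by (auto simp: c_def)
    moreover have "g O c gs \<subseteq> (\<Union>\<G>)\<^sup>*"
      using \<open>g \<subseteq> \<Union>\<G>\<close> Cons by (blast intro: converse_rtrancl_into_rtrancl)
    ultimately show ?case using Cons borel_pinj_relcomp by auto
  qed
  have "\<exists>w\<in>c ` lists \<G>. (x, y) \<in> w" if "(x, y) \<in> (\<Union>\<G>)\<^sup>*" "x \<in> space M" for x y
    using that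
  proof (induction rule: converse_rtrancl_induct)
    case base
    then have "(y, y) \<in> c []" by (simp add: c_def Id_onI)
    moreover have "[] \<in> lists \<G>" by simp
    ultimately show ?case by blast
  next
    case (step x z)
    then obtain g where g: "g \<in> \<G>" "(x, z) \<in> g" by blast
    then have "z \<in> space M" using borel_pinjD(1)[OF assms(2)] by blast
    then obtain gs where "gs \<in> lists \<G>" "(z, y) \<in> c gs" using step.IH by blast
    then have "(x, y) \<in> c (g # gs)" "g # gs \<in> lists \<G>" using g by (auto simp: c_def)
    then show ?case by blast
  qed
  then show ?thesis
    using c assms(1) by (intro exI[of _ "c ` lists \<G>"]) (auto intro!: countable_image countable_lists)
qed

section \<open>Null sets and matchings in an equivalence relation of type II_1\<close>

locale II1_equiv_rel = prob_space M for M :: "'a measure" +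
  fixes R :: "('a \<times> 'a) set"
  assumes std_borel: "standard_borel M" and meas_rel: "measured_equiv_rel M R"
    and II1: "type_II1 M R"
begin

lemma
  shows R_equiv: "equiv (space M) R"
    and R_sub: "R \<subseteq> space M \<times> space M"
    and R_sets: "R \<in> sets (M \<Otimes>\<^sub>M M)"
    and R_null: "Z \<in> null_sets M \<Longrightarrow> R `` Z \<in> null_sets M"
    and R_refl: "x \<in> space M \<Longrightarrow> (x, x) \<in> R"
    and R_sym: "(x, y) \<in> R \<Longrightarrow> (y, x) \<in> R"
    and R_trans: "(x, y) \<in> R \<Longrightarrow> (y, z) \<in> R \<Longrightarrow> (x, z) \<in> R"
  using meas_rel unfolding measured_equiv_rel_def
  by (auto simp: equiv_def refl_on_def dest: symD transD)

lemma R_saturation_sup: "A \<subseteq> space M \<Longrightarrow> A \<subseteq> R `` A"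
  using R_refl by blast

lemma R_saturation_idem: "R `` (R `` A) \<subseteq> R `` A"
  using R_trans by blast

lemma pinj_measure:
  assumes G: "borel_pinj M G" "G \<subseteq> R" and E: "E \<in> sets M"
  shows "emeasure M (G `` E) = emeasure M (E \<inter> Domain G)"
proof -
  obtain f where f: "bimeasurable_bij M (Domain G) M (Range G) f" "G = graph_on (Domain G) f"
    using borel_pinj_imp_bimeasurable_bij[OF G(1)] .
  then have "partial_automorphism M R (Domain G) (Range G) f"
    unfolding partial_automorphism_def using G(2) by simp
  moreover have "E \<inter> Domain G \<in> sets M" using E borel_pinj_Domain[OF G(1)] by blast
  ultimately have "emeasure M (f ` (E \<inter> Domain G)) = emeasure M (E \<inter> Domain G)"
    using II1 unfolding type_II1_def by blast
  moreover have "(x, y) \<in> G \<longleftrightarrow> x \<in> Domain G \<and> y = f x" for x y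
    by (metis f(2) mem_graph_on)
  then have "f ` (E \<inter> Domain G) = G `` E" by blast
  ultimately show ?thesis by simp
qed

lemma pinj_measure_Range:
  assumes "borel_pinj M G" "G \<subseteq> R"
  shows "measure M (Range G) = measure M (Domain G)"
proof -
  have "G `` space M = Range G" "space M \<inter> Domain G = Domain G"
    using borel_pinjD(1)[OF assms(1)] by blast+
  then show ?thesis
    using pinj_measure[OF assms, of "space M"] by (simp add: measure_def)
qed

text \<open>The integrand need not be measurable, so its integral is only compared with indicators
  of Borel subsets of the projection; \<open>null_projection\<close> does the rest.\<close>

lemma rel_mass_zero_imp_null:
  assumes E: "E \<in> sets (M \<Otimes>\<^sub>M M)" "rel_mass M E = 0"
  shows "\<exists>Z\<in>null_sets M. fst ` E \<subseteq> Z"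
proof (rule null_projection[OF finite_measure_axioms std_borel E(1)])
  fix S assume S: "S \<in> sets M" "S \<subseteq> fst ` E"
  have "emeasure M S = (\<integral>\<^sup>+ x. indicator S x \<partial>M)" using S(1) by simp
  also have "\<dots> \<le> rel_mass M E"
    unfolding rel_mass_def
  proof (intro nn_integral_mono)
    fix x
    show "indicator S x \<le> emeasure (count_space UNIV) {p \<in> E. fst p = x}"
    proof (cases "x \<in> S")
      case True
      then obtain y where "(x, y) \<in> E" using S(2) by auto
      then have "emeasure (count_space UNIV) {(x, y)} \<le> emeasure (count_space UNIV) {p \<in> E. fst p = x}"
        by (intro emeasure_mono) auto
      then show ?thesis using True by simp
    qed simp
  qed
  finally show "emeasure M S = 0" using E(2) by simp
qed

text \<open>On \<open>R\<close> the path relation agrees with the countable union of word graphs, so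
  the set of unreachable pairs is Borel and its projection lies in a Borel null set. Saturating that
  set makes a whole class good or bad at once.\<close>

lemma finite_graphing_countable_cover:
  assumes "finite_graphing M R K"
  shows "\<exists>W N. countable W \<and> (\<forall>w\<in>W. borel_pinj M w \<and> w \<subseteq> R) \<and> N \<in> null_sets M \<and> R `` N \<subseteq> N \<and>
    (\<forall>x y. (x, y) \<in> R \<longrightarrow> x \<notin> N \<longrightarrow> (x, y) \<in> (K \<union> K\<inverse>)\<^sup>* \<and> (\<exists>w\<in>W. (x, y) \<in> w))"
proof -
  obtain P where K: "K \<subseteq> R" "rel_mass M (R - (K \<union> K\<inverse>)\<^sup>*) = 0"
    and P: "finite P" "partition_on K P"
      "\<forall>G\<in>P. \<exists>A B f. partial_automorphism M R A B f \<and> G = graph_on A f"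
    using assms unfolding finite_graphing_def graphing_def by blast
  have P_pinj: "borel_pinj M G" if "G \<in> P" for G
    using bspec[OF P(3) that] borel_pinj_iff_partial_automorphism[of M G R] by simp
  let ?G = "P \<union> converse ` P"
  have "\<Union>P = K" using P(2) by (simp add: partition_on_def)
  then have UG: "\<Union>?G = K \<union> K\<inverse>" by blast
  have "borel_pinj M G" if "G \<in> ?G" for G using that P_pinj borel_pinj_converse by auto
  moreover have "countable ?G" using P(1) by (simp add: countable_finite)
  ultimately obtain W where W: "countable W" "\<forall>w\<in>W. borel_pinj M w \<and> w \<subseteq> (K \<union> K\<inverse>)\<^sup>*"
      "\<forall>x y. x \<in> space M \<longrightarrow> (x, y) \<in> (K \<union> K\<inverse>)\<^sup>* \<longrightarrow> (\<exists>w\<in>W. (x, y) \<in> w)"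
    using countable_path_relations[of ?G M] unfolding UG by blast
  have path_R: "(x, y) \<in> R" if "(x, y) \<in> (K \<union> K\<inverse>)\<^sup>*" "x \<in> space M" for x y
    using that by (induction rule: rtrancl_induct) (use K(1) R_refl R_sym R_trans in blast)+
  have wR: "w \<subseteq> R" if "w \<in> W" for w
  proof (rule subrelI)
    fix x y assume xy: "(x, y) \<in> w"
    have "x \<in> space M" using borel_pinjD(1)[of M w] W(2) that xy by blast
    moreover have "(x, y) \<in> (K \<union> K\<inverse>)\<^sup>*" using W(2) that xy by blast
    ultimately show "(x, y) \<in> R" by (rule path_R[rotated])
  qed
  have "(x, y) \<in> \<Union>W \<longleftrightarrow> (x, y) \<in> (K \<union> K\<inverse>)\<^sup>*" if "(x, y) \<in> R" for x y
  proof -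
    have "x \<in> space M" using that R_sub by blast
    then show ?thesis using W(2,3) by (meson UnionE UnionI subsetD)
  qed
  then have "R - \<Union>W = R - (K \<union> K\<inverse>)\<^sup>*" by auto
  moreover have "\<Union>W \<in> sets (M \<Otimes>\<^sub>M M)"
    using W(1,2) borel_pinj_sets[OF std_borel] by (intro sets.countable_Union) auto
  ultimately obtain Z where Z: "Z \<in> null_sets M" "fst ` (R - (K \<union> K\<inverse>)\<^sup>*) \<subseteq> Z"
    using rel_mass_zero_imp_null[of "R - (K \<union> K\<inverse>)\<^sup>*"] K(2) R_sets by (metis sets.Diff)
  have "(x, y) \<in> (K \<union> K\<inverse>)\<^sup>* \<and> (\<exists>w\<in>W. (x, y) \<in> w)" if xy: "(x, y) \<in> R" "x \<notin> R `` Z" for x y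
  proof -
    have "x \<in> space M" using R_sub xy(1) by blast
    then have "x \<notin> Z" using xy(2) R_refl by blast
    then have "(x, y) \<in> (K \<union> K\<inverse>)\<^sup>*" using Z(2) xy(1) by (metis DiffI fst_conv image_subset_iff)
    then show ?thesis using W(3) \<open>x \<in> space M\<close> by simp
  qed
  then show ?thesis
    using W(1,2) wR R_null[OF Z(1)] R_saturation_idem by (intro exI[of _ W] exI[of _ "R `` Z"]) simp
qed

text \<open>A greedy matching along countably many partial automorphisms that generate \<open>R\<close>. The unmatched
  parts of \<open>A\<close> and \<open>B\<close> are not joined by \<open>R\<close>, so by ergodicity one of them is null.\<close>

lemma ergodic_partial_automorphism:
  assumes "finitely_generated_rel M R" "ergodic_rel M R"
    and A: "A \<in> sets M" and B: "B \<in> sets M" and AB: "measure M A \<le> measure M B"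
  obtains G where "borel_pinj M G" "G \<subseteq> R" "G \<subseteq> A \<times> B" "A - Domain G \<in> null_sets M"
proof -
  obtain K where "finite_graphing M R K" using assms(1) unfolding finitely_generated_rel_def by blast
  then obtain W N where WN: "countable W \<and> (\<forall>w\<in>W. borel_pinj M w \<and> w \<subseteq> R) \<and>
      N \<in> null_sets M \<and> R `` N \<subseteq> N \<and>
      (\<forall>x y. (x, y) \<in> R \<longrightarrow> x \<notin> N \<longrightarrow> (x, y) \<in> (K \<union> K\<inverse>)\<^sup>* \<and> (\<exists>w\<in>W. (x, y) \<in> w))"
    by (elim finite_graphing_countable_cover[THEN exE] exE) (rule that)
  then have W: "countable W" "\<And>w. w \<in> W \<Longrightarrow> borel_pinj M w" "\<And>w. w \<in> W \<Longrightarrow> w \<subseteq> R"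
    and N: "N \<in> null_sets M" "R `` N \<subseteq> N"
    and cover: "\<And>x y. (x, y) \<in> R \<Longrightarrow> x \<notin> N \<Longrightarrow> \<exists>w\<in>W. (x, y) \<in> w"
    by simp_all
  \<comment> \<open>The empty relation guards against an empty \<open>W\<close>, for which
    \<open>from_nat_into\<close> would be unspecified; it matches nothing.\<close>
  define e where "e = from_nat_into (insert {} W)"
  have e: "borel_pinj M (e n)" "e n \<subseteq> R" for n
    using from_nat_into[of "insert {} W" n] W(2,3) borel_pinj_empty unfolding e_def by auto
  have e_cover: "\<exists>n. (x, y) \<in> e n" if "(x, y) \<in> R" "x \<notin> N" for x y
    using cover[OF that] from_nat_into_surj[of "insert {} W"] W(1) unfolding e_def
    by (metis countable_insert insertCI)
  define G where "G = rec_nat {} (\<lambda>n g. g \<union> (e n \<inter> (A - Domain g) \<times> (B - Range g)))"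
  have G0: "G 0 = {}" and GS: "\<And>n. G (Suc n) = G n \<union> (e n \<inter> (A - Domain (G n)) \<times> (B - Range (G n)))"
    unfolding G_def by simp_all
  have G: "borel_pinj M (G n) \<and> G n \<subseteq> R \<inter> A \<times> B" for n
  proof (induction n)
    case 0
    show ?case by (simp add: G0 borel_pinj_empty)
  next
    case (Suc n)
    have "borel_pinj M (e n \<inter> (A - Domain (G n)) \<times> (B - Range (G n)))"
      using Suc by (intro borel_pinj_restrict e sets.Diff A B borel_pinj_Domain borel_pinj_Range) simp_all
    then have "borel_pinj M (G (Suc n))"
      unfolding GS using Suc by (intro borel_pinj_Un) auto
    then show ?case using Suc e(2)[of n] unfolding GS by blast
  qed
  have inc: "incseq G" by (rule incseq_SucI) (simp add: GS)
  define H where "H = (\<Union>n. G n)"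
  have H: "borel_pinj M H" "H \<subseteq> R" "H \<subseteq> A \<times> B"
    unfolding H_def using G borel_pinj_UN_incseq[OF _ inc] by blast+
  define A' where "A' = A - Domain H"
  define B' where "B' = B - Range H"
  have A': "A' \<in> sets M" and B': "B' \<in> sets M"
    unfolding A'_def B'_def using A B borel_pinj_Domain[OF H(1)] borel_pinj_Range[OF H(1)] by auto
  \<comment> \<open>Both ends would still have been free when the relation \<open>e n\<close>
    joining them was processed, so the pair would have been matched.\<close>
  have "y \<notin> B'" if xy: "x \<in> A'" "(x, y) \<in> R" "x \<notin> N" for x y
  proof
    assume "y \<in> B'"
    obtain n where "(x, y) \<in> e n" using e_cover xy by blast
    then have "(x, y) \<in> G (Suc n)"
      using \<open>y \<in> B'\<close> xy(1) unfolding GS A'_def B'_def H_def by blast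
    then show False using xy(1) unfolding A'_def H_def by blast
  qed
  then have disj: "(R `` A' \<union> N) \<inter> B' \<subseteq> N" using N(2) by blast
  \<comment> \<open>Adding \<open>N\<close> makes the saturation Borel: outside \<open>N\<close> it
    is already reached by the countably many relations in \<open>W\<close>.\<close>
  define S where "S = R `` A' \<union> N"
  have "S = (\<Union>w\<in>W. w `` A') \<union> N"
  proof (intro equalityI subsetI)
    fix y assume "y \<in> S"
    show "y \<in> (\<Union>w\<in>W. w `` A') \<union> N"
    proof (cases "y \<in> N")
      case False
      then obtain x where x: "x \<in> A'" "(x, y) \<in> R" using \<open>y \<in> S\<close> unfolding S_def by blast
      then have "x \<notin> N" using False N(2) by blast
      then show ?thesis using cover[OF x(2)] x(1) by blast
    qed simp
  next
    fix y assume "y \<in> (\<Union>w\<in>W. w `` A') \<union> N"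
    then show "y \<in> S" unfolding S_def using subsetD[OF W(3)] by blast
  qed
  also have "\<dots> \<in> sets M"
    using W(1) borel_pinjD(4)[OF W(2) A'] N(1) by (intro sets.Un sets.countable_UN') auto
  finally have S: "S \<in> sets M" .
  have "S \<subseteq> space M" using sets.sets_into_space[OF S] .
  then have "S \<subseteq> R `` S" by (rule R_saturation_sup)
  moreover have "R `` S \<subseteq> S"
    using N(2) R_saturation_idem[of A'] unfolding S_def by blast
  ultimately have "R `` S = S" by blast
  then have "measure M S = 0 \<or> measure M S = 1"
    using assms(2) S unfolding ergodic_rel_def by blast
  then have "measure M A' = 0"
  proof
    assume "measure M S = 0"
    moreover have "A' \<subseteq> S" unfolding S_def using R_saturation_sup sets.sets_into_space[OF A'] by blast
    then have "measure M A' \<le> measure M S" using S by (rule finite_measure_mono)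
    ultimately show ?thesis by (simp add: measure_le_0_iff)
  next
    \<comment> \<open>Now \<open>B'\<close> is null, so \<open>H\<close> fills \<open>B\<close>.
      Invariance of the measure gives \<open>Domain H\<close> the measure of \<open>B\<close>, which
      is at least that of \<open>A\<close>.\<close>
    assume "measure M S = 1"
    then have "measure M (space M - S) = 0" using S prob_compl by simp
    moreover have "B' \<subseteq> (space M - S) \<union> N"
      using disj sets.sets_into_space[OF B'] unfolding S_def by blast
    then have "measure M B' \<le> measure M ((space M - S) \<union> N)"
      using S N(1) by (intro finite_measure_mono) auto
    moreover have "measure M ((space M - S) \<union> N) \<le> measure M (space M - S) + measure M N"
      using S N(1) by (intro measure_Un_le) auto
    moreover have "measure M N = 0" using N(1) by (simp add: null_sets_def measure_def)
    ultimately have "measure M B' = 0" using measure_nonneg[of M B'] by linarith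
    then have "measure M (Range H) = measure M B"
      using finite_measure_Diff[OF B borel_pinj_Range[OF H(1)]] H(3) unfolding B'_def by fastforce
    then have "measure M A \<le> measure M (Domain H)" using AB pinj_measure_Range[OF H(1,2)] by simp
    moreover have "measure M A' = measure M A - measure M (Domain H)"
      unfolding A'_def using H(3) by (intro finite_measure_Diff A borel_pinj_Domain[OF H(1)]) auto
    ultimately show ?thesis using measure_nonneg[of M A'] by linarith
  qed
  then have "A - Domain H \<in> null_sets M"
    using A' unfolding A'_def by (simp add: null_sets_def emeasure_eq_measure)
  with H that show thesis by blast
qed

end

subsection \<open>An upper bound for the isoperimetric constant\<close>

text \<open>Up to the null set \<open>N\<close>, the space is the disjoint union of \<open>n\<close> copies of \<open>Y\<close>, the \<open>i\<close>-th
  one being the range of \<open>\<phi> i\<close>, and \<open>\<G>\<close> generates the restriction of \<open>R\<close> to \<open>Y\<close>.\<close>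

locale shift_system = II1_equiv_rel +
  fixes Y N :: "'a set" and n :: nat and \<phi> :: "nat \<Rightarrow> ('a \<times> 'a) set" and \<G> :: "('a \<times> 'a) set set"
  assumes n: "0 < n"
    and \<phi>: "\<And>i. i < n \<Longrightarrow> borel_pinj M (\<phi> i)" "\<And>i. i < n \<Longrightarrow> \<phi> i \<subseteq> R"
    and \<phi>0: "\<phi> 0 = Id_on Y"
    and \<G>: "finite \<G>" "\<And>g. g \<in> \<G> \<Longrightarrow> borel_pinj M g" "\<And>g. g \<in> \<G> \<Longrightarrow> g \<subseteq> R" "\<And>g. g \<in> \<G> \<Longrightarrow> g \<subseteq> Y \<times> Y"
    and N: "N \<in> null_sets M" "R `` N \<subseteq> N"
    and \<phi>_Domain: "\<And>i y. i < n \<Longrightarrow> y \<in> Y \<Longrightarrow> y \<notin> N \<Longrightarrow> y \<in> Domain (\<phi> i)"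
    and \<phi>_Y: "\<And>i y x. i < n \<Longrightarrow> (y, x) \<in> \<phi> i \<Longrightarrow> y \<in> Y"
    and \<phi>_Range: "\<And>x. x \<in> space M \<Longrightarrow> x \<notin> N \<Longrightarrow> \<exists>i<n. x \<in> Range (\<phi> i)"
    and \<phi>_disj: "\<And>i j x y z. i < n \<Longrightarrow> j < n \<Longrightarrow> (y, x) \<in> \<phi> i \<Longrightarrow> (z, x) \<in> \<phi> j \<Longrightarrow> i = j"
    and path: "\<And>x y. x \<in> Y \<Longrightarrow> x \<notin> N \<Longrightarrow> y \<in> Y \<Longrightarrow> (x, y) \<in> R \<Longrightarrow> (x, y) \<in> (\<Union>\<G> \<union> (\<Union>\<G>)\<inverse>)\<^sup>*"
begin

definition X where "X = space M - N"

text \<open>Moves the \<open>i\<close>-th copy of \<open>Y\<close> to the \<open>(i + c)\<close>-th,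
  indices modulo \<open>n\<close>, keeping the base point. Elements of the full group are defined
  everywhere, so the identity fills \<open>N\<close>; cutting to \<open>X \<times> X\<close> keeps
  the two pieces apart.\<close>

definition shift where
  "shift c = (\<Union>i\<in>{..<n}. ((\<phi> i)\<inverse> O \<phi> ((i + c) mod n)) \<inter> X \<times> X) \<union> Id_on N"

lemma X_sat: "x \<in> X \<Longrightarrow> (x, y) \<in> R \<Longrightarrow> y \<in> X"
  using R_sub R_sym[of x y] N(2) unfolding X_def by blast

lemma X_sets: "X \<in> sets M" and X_AE: "AE x in M. x \<in> X"
proof -
  show "X \<in> sets M" unfolding X_def using N(1) by blast
  show "AE x in M. x \<in> X"
    using AE_not_in[OF N(1)] unfolding X_def by (auto elim: AE_mp intro!: AE_I2)
qed

lemma X_nonempty: "X \<noteq> {}"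
proof
  assume "X = {}"
  then have "AE x in M. False" using X_AE by simp
  then show False by simp
qed

lemma \<phi>_unique:
  assumes "i < n" "j < n" "(a, x) \<in> \<phi> i" "(b, x) \<in> \<phi> j"
  shows "i = j \<and> a = b"
proof -
  have "i = j" using \<phi>_disj assms by blast
  then show ?thesis using borel_pinjD(3)[OF \<phi>(1)] assms by blast
qed

lemma \<phi>_R: "i < n \<Longrightarrow> (a, x) \<in> \<phi> i \<Longrightarrow> (a, x) \<in> R"
  using \<phi>(2) by blast

lemma base_point:
  assumes "x \<in> X"
  obtains i a where "i < n" "(a, x) \<in> \<phi> i" "a \<in> Y" "a \<in> X"
proof -
  obtain i a where ia: "i < n" "(a, x) \<in> \<phi> i" using \<phi>_Range assms unfolding X_def by blast
  then have "a \<in> X" using X_sat[OF assms] R_sym[OF \<phi>_R] by blast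
  then show thesis using that ia \<phi>_Y by blast
qed

lemma shift_iff:
  "(x, y) \<in> shift c \<longleftrightarrow> (x \<in> N \<and> y = x) \<or>
     (x \<in> X \<and> y \<in> X \<and> (\<exists>i<n. \<exists>a. (a, x) \<in> \<phi> i \<and> (a, y) \<in> \<phi> ((i + c) mod n)))"
  unfolding shift_def by blast

lemma shift_sub: "shift c \<subseteq> R"
proof (rule subrelI)
  fix x y assume "(x, y) \<in> shift c"
  then consider "x \<in> N" "y = x" | i a where "i < n" "(a, x) \<in> \<phi> i" "(a, y) \<in> \<phi> ((i + c) mod n)"
    unfolding shift_iff by blast
  then show "(x, y) \<in> R"
  proof cases
    case 1
    then show ?thesis using R_refl sets.sets_into_space[OF null_setsD2[OF N(1)]] by blast
  next
    case 2
    then have "(a, x) \<in> R" "(a, y) \<in> R" using \<phi>_R n mod_less_divisor[OF n] by blast+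
    then show ?thesis using R_sym R_trans by blast
  qed
qed

lemma mod_shift_inj: "i < n \<Longrightarrow> j < n \<Longrightarrow> c < n \<Longrightarrow> (i + c) mod n = (j + c) mod n \<Longrightarrow> i = j"
  by (auto simp: mod_if split: if_splits)

lemma shift_pinj:
  assumes c: "c < n"
  shows "borel_pinj M (shift c)"
  unfolding shift_def
proof (rule borel_pinj_Un)
  have nn: "k mod n < n" for k using n by simp
  show "borel_pinj M (\<Union>i\<in>{..<n}. ((\<phi> i)\<inverse> O \<phi> ((i + c) mod n)) \<inter> X \<times> X)" (is "borel_pinj M ?U")
  proof (rule borel_pinj_UN)
    fix i assume "i \<in> {..<n}"
    then show "borel_pinj M (((\<phi> i)\<inverse> O \<phi> ((i + c) mod n)) \<inter> X \<times> X)"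
      by (intro borel_pinj_restrict borel_pinj_relcomp borel_pinj_converse \<phi>(1) X_sets nn) simp
  next
    show "single_valued ?U"
    proof (rule single_valuedI)
      fix x y z assume "(x, y) \<in> ?U" "(x, z) \<in> ?U"
      then obtain i j a b where *: "i < n" "(a, x) \<in> \<phi> i" "(a, y) \<in> \<phi> ((i + c) mod n)"
          "j < n" "(b, x) \<in> \<phi> j" "(b, z) \<in> \<phi> ((j + c) mod n)"
        by auto
      then have "i = j" "a = b" using \<phi>_unique by blast+
      then show "y = z" using * borel_pinjD(2)[OF \<phi>(1)[OF nn]] by blast
    qed
    show "single_valued (?U\<inverse>)"
    proof (rule single_valuedI)
      fix z x y assume "(z, x) \<in> ?U\<inverse>" "(z, y) \<in> ?U\<inverse>"
      then obtain i j a b where *: "i < n" "(a, x) \<in> \<phi> i" "(a, z) \<in> \<phi> ((i + c) mod n)"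
          "j < n" "(b, y) \<in> \<phi> j" "(b, z) \<in> \<phi> ((j + c) mod n)"
        by auto
      then have "(i + c) mod n = (j + c) mod n" "a = b" using \<phi>_unique[OF nn nn] by blast+
      then have "i = j" using mod_shift_inj c * by blast
      then show "x = y" using * \<open>a = b\<close> borel_pinjD(2)[OF \<phi>(1)] by blast
    qed
  qed simp
  show "borel_pinj M (Id_on N)" using N(1) by (intro borel_pinj_Id_on) blast
qed (auto simp: X_def)

lemma shift_Domain:
  assumes "x \<in> space M"
  shows "x \<in> Domain (shift c)"
proof (cases "x \<in> N")
  case False
  then have x: "x \<in> X" using assms by (simp add: X_def)
  then obtain i a where ia: "i < n" "(a, x) \<in> \<phi> i" "a \<in> Y" "a \<in> X" by (rule base_point)
  have k: "(i + c) mod n < n" using n by simp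
  then obtain y where y: "(a, y) \<in> \<phi> ((i + c) mod n)"
    using \<phi>_Domain[OF k ia(3)] ia(4) unfolding X_def by blast
  then have "y \<in> X" using X_sat[OF ia(4)] \<phi>_R[OF k] by blast
  then have "(x, y) \<in> shift c" unfolding shift_iff using x ia(1,2) y by blast
  then show ?thesis by blast
qed (use shift_iff in blast)

lemma shift_Range:
  assumes "c < n" "y \<in> space M"
  shows "y \<in> Range (shift c)"
proof (cases "y \<in> N")
  case False
  then have y: "y \<in> X" using assms by (simp add: X_def)
  then obtain j a where ja: "j < n" "(a, y) \<in> \<phi> j" "a \<in> Y" "a \<in> X" by (rule base_point)
  \<comment> \<open>The index with \<open>i + c\<close> congruent to \<open>j\<close> modulo
    \<open>n\<close>; adding \<open>n - c\<close> instead of subtracting \<open>c\<close> avoids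
    truncated subtraction.\<close>
  define i where "i = (j + (n - c)) mod n"
  have i: "i < n" using n by (simp add: i_def)
  have "(i + c) mod n = (j + (n - c) + c) mod n" unfolding i_def by (rule mod_add_left_eq)
  then have ic: "(i + c) mod n = j" using assms(1) ja(1) by simp
  obtain x where x: "(a, x) \<in> \<phi> i"
    using \<phi>_Domain[OF i ja(3)] ja(4) unfolding X_def by blast
  then have "x \<in> X" using X_sat[OF ja(4)] \<phi>_R[OF i] by blast
  then have "(x, y) \<in> shift c" unfolding shift_iff using y i x ja(2) ic by blast
  then show ?thesis by blast
qed (use shift_iff in blast)

lemma shift_symmetric_vertex:
  assumes "c < n"
  shows "shift c \<in> symmetric_vertices M R"
proof (rule borel_pinj_in_full_group[OF shift_pinj[OF assms] shift_sub])
  show "Domain (shift c) = space M"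
    using shift_Domain borel_pinjD(1)[OF shift_pinj[OF assms]] by blast
  show "Range (shift c) = space M"
    using shift_Range[OF assms] borel_pinjD(1)[OF shift_pinj[OF assms]] by blast
qed

text \<open>The points \<open>x\<close> and \<open>y\<close> determine the indices of their copies,
  and \<open>c\<close> is the difference of these modulo \<open>n\<close>.\<close>

lemma shift_disjoint:
  assumes "c < n" "d < n" "x \<in> X" "(x, y) \<in> shift c" "(x, y) \<in> shift d"
  shows "c = d"
proof -
  have "x \<notin> N" using assms(3) by (simp add: X_def)
  then obtain i a j b where *: "i < n" "(a, x) \<in> \<phi> i" "(a, y) \<in> \<phi> ((i + c) mod n)"
      "j < n" "(b, x) \<in> \<phi> j" "(b, y) \<in> \<phi> ((j + d) mod n)"
    using assms(4,5) unfolding shift_iff by auto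
  then have "i = j" using \<phi>_unique by blast
  then have "(c + i) mod n = (d + i) mod n"
    using * \<phi>_unique[of "(i + c) mod n" "(j + d) mod n"] n by (simp add: add.commute)
  then show ?thesis using mod_shift_inj assms(1,2) *(1) by blast
qed

lemma rel_mass_null:
  assumes "\<And>x y. (x, y) \<in> E \<Longrightarrow> x \<notin> X"
  shows "rel_mass M E = 0"
proof -
  have "AE x in M. emeasure (count_space UNIV) {p \<in> E. fst p = x} = 0"
    using X_AE
  proof (rule AE_mp, intro AE_I2 impI)
    fix x assume "x \<in> X"
    then have "{p \<in> E. fst p = x} = {}" using assms by auto
    then show "emeasure (count_space UNIV) {p \<in> E. fst p = x} = 0" by (simp only: emeasure_empty)
  qed
  then have "rel_mass M E = (\<integral>\<^sup>+ x. 0 \<partial>M)"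
    unfolding rel_mass_def by (rule nn_integral_cong_AE)
  then show ?thesis by simp
qed

definition shifts where "shifts = shift ` {..<n}"

text \<open>A family is a set, in which equal shifts would count once; any point of \<open>X\<close>
  tells them apart.\<close>

lemma shifts_card: "card shifts = n"
proof -
  have "inj_on shift {..<n}"
  proof (rule inj_onI)
    fix c d assume cd: "c \<in> {..<n}" "d \<in> {..<n}" "shift c = shift d"
    obtain x where x: "x \<in> X" using X_nonempty by blast
    then obtain y where "(x, y) \<in> shift c" using shift_Domain unfolding X_def by blast
    then show "c = d" using shift_disjoint[OF _ _ x] cd by auto
  qed
  then show ?thesis unfolding shifts_def by (simp add: card_image)
qed

lemma shifts_family: "shifts \<in> disjoint_symmetric_families M R"
proof -
  have "rel_mass M (shift c \<inter> shift d) = 0" if "c < n" "d < n" "shift c \<noteq> shift d" for c d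
  proof (rule rel_mass_null)
    fix x y assume "(x, y) \<in> shift c \<inter> shift d"
    then show "x \<notin> X" using shift_disjoint[OF that(1,2)] that(3) by blast
  qed
  then have "pairwise (\<lambda>U V. rel_mass M (U \<inter> V) = 0) shifts"
    unfolding shifts_def pairwise_def by auto
  then show ?thesis
    unfolding disjoint_symmetric_families_def
    using shift_symmetric_vertex n by (auto simp: shifts_def)
qed

text \<open>As \<open>c\<close> runs through all residues, the copy of \<open>y\<close> becomes
  arbitrary and only the base point \<open>a\<close> is remembered.\<close>

lemma mem_shifts:
  assumes "i < n" "(a, x) \<in> \<phi> i" "x \<in> X" "y \<in> X"
  shows "(x, y) \<in> \<Union>shifts \<longleftrightarrow> (\<exists>j<n. (a, y) \<in> \<phi> j)"
proof
  assume "(x, y) \<in> \<Union>shifts"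
  then obtain c where "(x, y) \<in> shift c" unfolding shifts_def by blast
  then obtain k b where k: "k < n" "(b, x) \<in> \<phi> k" "(b, y) \<in> \<phi> ((k + c) mod n)"
    using assms(3) unfolding shift_iff X_def by auto
  then have "b = a" using \<phi>_unique assms(1,2) by blast
  then show "\<exists>j<n. (a, y) \<in> \<phi> j" using k(3) mod_less_divisor[OF n] by blast
next
  assume "\<exists>j<n. (a, y) \<in> \<phi> j"
  then obtain j where j: "j < n" "(a, y) \<in> \<phi> j" by blast
  define c where "c = (j + (n - i)) mod n"
  have c: "c < n" using n by (simp add: c_def)
  have "(i + c) mod n = (i + (j + (n - i))) mod n" unfolding c_def by (rule mod_add_right_eq)
  then have "(i + c) mod n = j" using assms(1) j(1) by simp
  then have "(x, y) \<in> shift c" unfolding shift_iff using assms j by blast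
  then show "(x, y) \<in> \<Union>shifts" using c unfolding shifts_def by blast
qed

definition gens where "gens = \<G> \<union> \<phi> ` {..<n}"

lemma gens_pinj: "finite gens" "g \<in> gens \<Longrightarrow> borel_pinj M g" "g \<in> gens \<Longrightarrow> g \<subseteq> R"
proof -
  show "finite gens" unfolding gens_def using \<G>(1) by simp
  show "borel_pinj M g" "g \<subseteq> R" if "g \<in> gens"
  proof -
    consider "g \<in> \<G>" | i where "i < n" "g = \<phi> i" using \<open>g \<in> gens\<close> unfolding gens_def by auto
    then have "borel_pinj M g \<and> g \<subseteq> R" by cases (use \<G>(2,3) \<phi> in simp_all)
    then show "borel_pinj M g" "g \<subseteq> R" by simp_all
  qed
qed

text \<open>Descend from \<open>x\<close> to its base point, travel inside \<open>Y\<close>, and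
  climb to \<open>y\<close>.\<close>

lemma gens_path:
  assumes x: "x \<in> X" and xy: "(x, y) \<in> R"
  shows "(x, y) \<in> (\<Union>gens \<union> (\<Union>gens)\<inverse>)\<^sup>*"
proof -
  let ?L = "\<Union>gens \<union> (\<Union>gens)\<inverse>"
  have y: "y \<in> X" using X_sat x xy .
  obtain i a where a: "i < n" "(a, x) \<in> \<phi> i" "a \<in> Y" "a \<in> X" using x by (rule base_point)
  obtain j b where b: "j < n" "(b, y) \<in> \<phi> j" "b \<in> Y" "b \<in> X" using y by (rule base_point)
  have "(a, b) \<in> R" using \<phi>_R[OF a(1,2)] \<phi>_R[OF b(1,2)] xy R_sym R_trans by blast
  moreover have "a \<notin> N" using a(4) by (simp add: X_def)
  ultimately have "(a, b) \<in> (\<Union>\<G> \<union> (\<Union>\<G>)\<inverse>)\<^sup>*" using path a(3) b(3) by blast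
  moreover have "\<Union>\<G> \<union> (\<Union>\<G>)\<inverse> \<subseteq> ?L" unfolding gens_def by blast
  ultimately have "(a, b) \<in> ?L\<^sup>*" using rtrancl_mono by blast
  moreover have "(x, a) \<in> ?L" using a(1,2) unfolding gens_def by blast
  moreover have "(b, y) \<in> ?L" using b(1,2) unfolding gens_def by blast
  ultimately show ?thesis by (meson converse_rtrancl_into_rtrancl rtrancl.rtrancl_into_rtrancl)
qed

lemma gens_finite_graphing: "finite_graphing M R (\<Union>gens)"
  unfolding finite_graphing_def graphing_def
proof (intro conjI)
  show "\<Union>gens \<in> sets (M \<Otimes>\<^sub>M M)"
    using gens_pinj borel_pinj_sets[OF std_borel] by (intro sets.finite_Union) auto
  show sub: "\<Union>gens \<subseteq> R" using gens_pinj by blast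
  show "rel_mass M (R - (\<Union>gens \<union> (\<Union>gens)\<inverse>)\<^sup>*) = 0"
    by (rule rel_mass_null) (use gens_path in blast)
  obtain P where P: "finite P" "partition_on (\<Union>gens) P" "\<forall>G\<in>P. borel_pinj M G"
    using borel_pinj_partition[OF std_borel gens_pinj(1,2)] by blast
  have "\<exists>A B f. partial_automorphism M R A B f \<and> G = graph_on A f" if "G \<in> P" for G
  proof -
    have "G \<subseteq> R" using sub P(2) that unfolding partition_on_def by blast
    then show ?thesis using P(3) that borel_pinj_iff_partial_automorphism[of M G R] by simp
  qed
  then show "\<exists>P. finite P \<and> partition_on (\<Union>gens) P \<and>
      (\<forall>G\<in>P. \<exists>A B f. partial_automorphism M R A B f \<and> G = graph_on A f)"
    using P(1,2) by blast
qed

text \<open>The edges inside the copies of \<open>Y\<close> given by the \<open>\<phi> i\<close> never leave the family of shifts, so a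
  boundary edge over \<open>x\<close> is an edge of \<open>\<Union>\<G>\<close> at the point of \<open>Y\<close> below \<open>x\<close>.\<close>

lemma edge_boundary_card:
  assumes x: "x \<in> X"
  shows "emeasure (count_space UNIV) {e \<in> edge_boundary R (\<Union>gens) shifts. fst (fst e) = x}
    \<le> of_nat (2 * card \<G>)"
proof -
  obtain i a where a: "i < n" "(a, x) \<in> \<phi> i" "a \<in> Y" "a \<in> X" using x by (rule base_point)
  \<comment> \<open>Crossing edges have an end at \<open>(x, a)\<close>, and each generator has at
    most one edge leaving \<open>a\<close> and one entering it. Where there is none,
    \<open>THE\<close> yields an arbitrary pair, which only enlarges \<open>S\<close>.\<close>
  define S where "S = (\<lambda>g. ((x, a), (x, THE z. (a, z) \<in> g))) ` \<G> \<union>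
    (\<lambda>g. ((x, THE y. (y, a) \<in> g), (x, a))) ` \<G>"
  \<comment> \<open>Since \<open>\<phi> 0\<close> is the identity of \<open>Y\<close>, a point of
    \<open>Y\<close> is its own base point.\<close>
  have Y_iff: "(x, y) \<in> \<Union>shifts \<longleftrightarrow> y = a" if "y \<in> Y" "y \<in> X" for y
  proof -
    have "(y, y) \<in> \<phi> 0" using that(1) \<phi>0 by (simp add: Id_onI)
    have "(\<exists>j<n. (a, y) \<in> \<phi> j) \<longleftrightarrow> y = a"
    proof
      assume "\<exists>j<n. (a, y) \<in> \<phi> j"
      then show "y = a" using \<phi>_unique n \<open>(y, y) \<in> \<phi> 0\<close> by blast
    next
      assume "y = a"
      then show "\<exists>j<n. (a, y) \<in> \<phi> j" using n \<open>(y, y) \<in> \<phi> 0\<close> by blast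
    qed
    then show ?thesis using mem_shifts[OF a(1,2) x that(2)] by simp
  qed
  have "{e \<in> edge_boundary R (\<Union>gens) shifts. fst (fst e) = x} \<subseteq> S"
  proof
    fix e assume "e \<in> {e \<in> edge_boundary R (\<Union>gens) shifts. fst (fst e) = x}"
    then obtain y z where e: "e = ((x, y), (x, z))" and yz: "(x, y) \<in> R" "(x, z) \<in> R" "(y, z) \<in> \<Union>gens"
      and ne: "((x, y) \<in> \<Union>shifts) \<noteq> ((x, z) \<in> \<Union>shifts)"
    proof -
      from \<open>e \<in> _\<close> have eb: "e \<in> edge_boundary R (\<Union>gens) shifts" "fst (fst e) = x" by simp_all
      obtain u v where uv: "e = (u, v)" "(u, v) \<in> cayley_edges R (\<Union>gens)"
          "(u \<in> \<Union>shifts) \<noteq> (v \<in> \<Union>shifts)"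
        using eb(1) unfolding edge_boundary_def by blast
      from uv(2) obtain x' y z where xyz: "u = (x', y)" "v = (x', z)" "(x', y) \<in> R" "(x', z) \<in> R"
          "(y, z) \<in> \<Union>gens"
        unfolding cayley_edges_def by blast
      have "x' = x" using eb(2) uv(1) xyz(1) by simp
      then show thesis using that[of y z] uv xyz by simp
    qed
    have X: "y \<in> X" "z \<in> X" using X_sat[OF x] yz by blast+
    have "\<exists>g\<in>\<G>. (y, z) \<in> g"
    proof (rule ccontr)
      assume "\<not> ?thesis"
      then obtain k where k: "k < n" "(y, z) \<in> \<phi> k" using yz(3) unfolding gens_def by auto
      then have "y \<in> Y" using \<phi>_Y by blast
      \<comment> \<open>An edge of \<open>\<phi> k\<close> starts at the base point of its end, so
        either both ends belong to the family or neither does.\<close>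
      have "(\<exists>j<n. (a, z) \<in> \<phi> j) \<longleftrightarrow> y = a" using \<phi>_unique k by blast
      then show False using ne Y_iff[OF \<open>y \<in> Y\<close> X(1)] mem_shifts[OF a(1,2) x X(2)]
        by (simp only: not_True_eq_False)
    qed
    then obtain g where g: "g \<in> \<G>" "(y, z) \<in> g" by blast
    then have "y \<in> Y" "z \<in> Y" using \<G>(4) by blast+
    then have "y = a \<or> z = a" using ne Y_iff X by blast
    then show "e \<in> S"
    proof
      assume ya: "y = a"
      have "(THE w. (a, w) \<in> g) = z"
        using borel_pinjD(2)[OF \<G>(2)[OF g(1)]] g(2) ya by (intro the_equality) blast+
      then have "e = ((x, a), (x, THE w. (a, w) \<in> g))" using e ya by simp
      then show ?thesis unfolding S_def using g(1) by blast
    next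
      assume za: "z = a"
      have "(THE w. (w, a) \<in> g) = y"
        using borel_pinjD(3)[OF \<G>(2)[OF g(1)]] g(2) za by (intro the_equality) blast+
      then have "e = ((x, THE w. (w, a) \<in> g), (x, a))" using e za by simp
      then show ?thesis unfolding S_def using g(1) by blast
    qed
  qed
  moreover have "finite S" unfolding S_def using \<G>(1) by simp
  ultimately have "emeasure (count_space UNIV) {e \<in> edge_boundary R (\<Union>gens) shifts. fst (fst e) = x}
      \<le> emeasure (count_space UNIV) S"
    by (intro emeasure_mono) auto
  also have "\<dots> = of_nat (card S)" using \<open>finite S\<close> by (simp add: emeasure_count_space)
  also have "\<dots> \<le> of_nat (2 * card \<G>)"
  proof -
    have "card S \<le> card \<G> + card \<G>"
      unfolding S_def by (rule order_trans[OF card_Un_le]) (intro add_mono card_image_le \<G>(1))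
    then have "card S \<le> 2 * card \<G>" by simp
    then show ?thesis by (rule of_nat_mono)
  qed
  finally show ?thesis .
qed

theorem isoperimetric_const_le: "isoperimetric_const M R \<le> of_nat (2 * card \<G>) / of_nat n"
proof -
  have "edge_mass M (edge_boundary R (\<Union>gens) shifts) \<le> (\<integral>\<^sup>+ x. of_nat (2 * card \<G>) \<partial>M)"
    unfolding edge_mass_def
    by (rule nn_integral_mono_AE) (rule AE_mp[OF X_AE], intro AE_I2 impI edge_boundary_card)
  then have "edge_mass M (edge_boundary R (\<Union>gens) shifts) \<le> of_nat (2 * card \<G>)"
    by (simp add: emeasure_space_1)
  then have "edge_mass M (edge_boundary R (\<Union>gens) shifts) / of_nat (card shifts)
      \<le> of_nat (2 * card \<G>) / of_nat n"
    unfolding shifts_card by (rule divide_right_mono_ennreal)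
  then have "isoperimetric_const_wrt M R (\<Union>gens) \<le> of_nat (2 * card \<G>) / of_nat n"
    unfolding isoperimetric_const_wrt_def by (rule INF_lower2[OF shifts_family])
  then show ?thesis
    unfolding isoperimetric_const_def
    by (rule INF_lower2[rotated]) (simp add: gens_finite_graphing)
qed

end

subsection \<open>Scaling maps\<close>

text \<open>The inverse of an isomorphism from a restriction onto \<open>R\<close>, seen as a
  self-embedding of the whole relation. In this direction composition is always possible and
  multiplies the factors. For \<open>s \<noteq> 0\<close> the measure condition already makes the
  domain conull.\<close>

definition scaling :: "'a measure \<Rightarrow> ('a \<times> 'a) set \<Rightarrow> real \<Rightarrow> ('a \<times> 'a) set \<Rightarrow> bool" where
  "scaling M R s H \<longleftrightarrow> borel_pinj M H \<and> (\<forall>E\<in>sets M. measure M (H `` E) = s * measure M E) \<and>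
     (\<forall>x y x' y'. (x, y) \<in> H \<longrightarrow> (x', y') \<in> H \<longrightarrow> ((x, x') \<in> R \<longleftrightarrow> (y, y') \<in> R))"

lemma scaling_relcomp:
  assumes "scaling M R s G" "scaling M R t H"
  shows "scaling M R (t * s) (G O H)"
proof -
  have G: "borel_pinj M G" and H: "borel_pinj M H" using assms unfolding scaling_def by simp_all
  have "measure M ((G O H) `` E) = t * s * measure M E" if "E \<in> sets M" for E
    using assms that borel_pinjD(4)[OF G that] unfolding scaling_def relcomp_Image by simp
  moreover have "(x, x') \<in> R \<longleftrightarrow> (z, z') \<in> R" if xz: "(x, z) \<in> G O H" "(x', z') \<in> G O H" for x x' z z'
  proof -
    obtain y y' where "(x, y) \<in> G" "(y, z) \<in> H" "(x', y') \<in> G" "(y', z') \<in> H" using xz by blast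
    then show ?thesis using assms unfolding scaling_def by simp
  qed
  ultimately show ?thesis unfolding scaling_def using borel_pinj_relcomp[OF G H] by simp
qed

lemma scaling_power:
  assumes "scaling M R t H"
  shows "\<exists>H'. scaling M R (t ^ k) H'"
proof (induction k)
  case 0
  have "Id_on (space M) `` E = E" if "E \<in> sets M" for E
    using sets.sets_into_space[OF that] by auto
  then have "scaling M R (t ^ 0) (Id_on (space M))"
    unfolding scaling_def by (auto intro: borel_pinj_Id_on)
  then show ?case by blast
next
  case (Suc k)
  then show ?case using scaling_relcomp[OF _ assms] by auto
qed

text \<open>The isomorphism carries the normalized measure of \<open>Y\<close> to \<open>M\<close>,
  so undoing the normalization leaves the factor \<open>measure M Y\<close> for its inverse.\<close>

lemma isomorphic_rel_imp_scaling:
  assumes "prob_space M" and Y: "Y \<in> sets M" "emeasure M Y > 0"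
    and iso: "isomorphic_rel (normalized_restriction M Y) (restrict_rel R Y) M R"
  shows "\<exists>H. scaling M R (measure M Y) H"
proof -
  interpret prob_space M by fact
  let ?N = "normalized_restriction M Y"
  obtain A B f where f: "bimeasurable_bij ?N A M B f" "space M - B \<in> null_sets M"
      "distr (restrict_space ?N A) (restrict_space M B) f = restrict_space M B"
      "\<forall>x\<in>A. \<forall>y\<in>A. (x, y) \<in> restrict_rel R Y \<longleftrightarrow> (f x, f y) \<in> R"
    using iso unfolding isomorphic_rel_def by blast
  have N_sets: "sets ?N = sets (restrict_space M Y)"
    unfolding normalized_restriction_def by simp
  then have "space ?N = space (restrict_space M Y)" by (rule sets_eq_imp_space_eq)
  then have N_space: "space ?N = Y"
    using sets.sets_into_space[OF Y(1)] by (auto simp: space_restrict_space)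
  have A: "A \<in> sets M" "A \<subseteq> Y"
    using f(1) Y(1) unfolding bimeasurable_bij_def N_sets by (auto simp: sets_restrict_space_iff)
  have B: "B \<in> sets M" and bij: "bij_betw f A B" using f(1) unfolding bimeasurable_bij_def by auto
  have NA: "sets (restrict_space ?N A) = sets (restrict_space M A)"
  proof -
    have "E \<in> sets (restrict_space ?N A) \<longleftrightarrow> E \<in> sets (restrict_space M A)" for E
      using A Y(1) N_sets N_space
      by (subst sets_restrict_space_iff) (auto simp: sets_restrict_space_iff)
    then show ?thesis by blast
  qed
  have "f \<in> restrict_space ?N A \<rightarrow>\<^sub>M restrict_space M B"
      "the_inv_into A f \<in> restrict_space M B \<rightarrow>\<^sub>M restrict_space ?N A"
    using f(1) unfolding bimeasurable_bij_def by auto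
  then have "bimeasurable_bij M A M B f"
    unfolding bimeasurable_bij_def using A B bij
    by (simp add: measurable_cong_sets[OF NA refl] measurable_cong_sets[OF refl NA])
  then have G: "borel_pinj M (graph_on A f)" by (rule bimeasurable_bij_imp_borel_pinj)
  define H where "H = (graph_on A f)\<inverse>"
  have H: "borel_pinj M H" unfolding H_def by (rule borel_pinj_converse[OF G])
  have H_iff: "(y, x) \<in> H \<longleftrightarrow> x \<in> A \<and> y = f x" for x y
    unfolding H_def converse_iff mem_graph_on ..
  have "measure M (H `` E) = measure M Y * measure M E" if E: "E \<in> sets M" for E
  proof -
    let ?E = "E \<inter> B"
    have HE: "H `` E = f -` ?E \<inter> A"
      using bij unfolding bij_betw_def by (auto simp: H_iff)
    have HE_sets: "H `` E \<in> sets M" using borel_pinjD(4)[OF H E] .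
    have spA: "space (restrict_space ?N A) = A" using A N_space by (auto simp: space_restrict_space)
    \<comment> \<open>The image of \<open>f\<close> is only the conull set \<open>B\<close>.\<close>
    have "emeasure M E = emeasure M ?E"
    proof (rule emeasure_eq_AE)
      show "AE x in M. x \<in> E \<longleftrightarrow> x \<in> ?E"
        using AE_not_in[OF f(2)] by (rule AE_mp) (auto intro!: AE_I2)
    qed (use E B in auto)
    also have "\<dots> = emeasure (restrict_space M B) ?E"
      using B E by (subst emeasure_restrict_space) auto
    also have "\<dots> = emeasure (distr (restrict_space ?N A) (restrict_space M B) f) ?E"
      using f(3) by simp
    also have "\<dots> = emeasure (restrict_space ?N A) (H `` E)"
      unfolding HE using f(1) B E spA unfolding bimeasurable_bij_def
      by (subst emeasure_distr) (auto simp: sets_restrict_space_iff)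
    also have "\<dots> = emeasure ?N (H `` E)"
      using A Y(1) HE N_sets N_space by (subst emeasure_restrict_space) (auto simp: sets_restrict_space_iff)
    also have "\<dots> = inverse (emeasure M Y) * emeasure (restrict_space M Y) (H `` E)"
      unfolding normalized_restriction_def by simp
    also have "emeasure (restrict_space M Y) (H `` E) = emeasure M (H `` E)"
      using Y(1) HE A by (subst emeasure_restrict_space) auto
    finally have "emeasure M E = inverse (emeasure M Y) * emeasure M (H `` E)" .
    then have "emeasure M Y * emeasure M E
        = emeasure M Y * inverse (emeasure M Y) * emeasure M (H `` E)"
      by (simp add: mult.assoc)
    also have "emeasure M Y * inverse (emeasure M Y) = 1"
      using Y(2) ennreal_divide_self[of "emeasure M Y"]
      by (simp add: divide_ennreal_def emeasure_eq_measure)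
    finally have "emeasure M (H `` E) = emeasure M Y * emeasure M E" by simp
    then show ?thesis by (simp add: measure_def enn2real_mult)
  qed
  moreover have "(x, x') \<in> R \<longleftrightarrow> (y, y') \<in> R" if "(x, y) \<in> H" "(x', y') \<in> H" for x y x' y'
    using that f(4) A(2) unfolding H_iff restrict_rel_def by auto
  ultimately show ?thesis using H unfolding scaling_def by blast
qed

section \<open>Disjoint copies of a set of measure \<open>1 / n\<close>\<close>

context II1_equiv_rel
begin

lemma null_setsI_measure: "Z \<in> sets M \<Longrightarrow> measure M Z = 0 \<Longrightarrow> Z \<in> null_sets M"
  by (simp add: null_sets_def emeasure_eq_measure)

text \<open>As long as fewer than \<open>n\<close> copies are placed, the uncovered part has measure
  at least \<open>1 / n\<close>, so the ergodic matching fits another one. The initial copy is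
  \<open>Y\<close> itself, which makes points of \<open>Y\<close> their own base points.\<close>

lemma partial_copies:
  assumes R: "finitely_generated_rel M R" "ergodic_rel M R"
    and Y: "Y \<in> sets M" "measure M Y = 1 / real n" and n: "0 < n"
    and m: "1 \<le> m" "m \<le> n"
  shows "\<exists>\<phi>. \<phi> 0 = Id_on Y \<and>
    (\<forall>i<m. borel_pinj M (\<phi> i) \<and> \<phi> i \<subseteq> R \<and> \<phi> i \<subseteq> Y \<times> space M \<and> Y - Domain (\<phi> i) \<in> null_sets M) \<and>
    disjoint_family_on (\<lambda>i. Range (\<phi> i)) {..<m} \<and>
    measure M (\<Union>i<m. Range (\<phi> i)) = real m / real n"
  using m
proof (induction m rule: nat_induct_at_least)
  case base
  have "Id_on Y \<subseteq> R" "Id_on Y \<subseteq> Y \<times> space M"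
    using R_refl sets.sets_into_space[OF Y(1)] by auto
  then show ?case
    using Y borel_pinj_Id_on[OF Y(1)]
    by (intro exI[of _ "\<lambda>_. Id_on Y"]) (auto simp: disjoint_family_on_def lessThan_Suc)
next
  case (Suc m)
  then obtain \<phi> where \<phi>0: "\<phi> 0 = Id_on Y"
    and \<phi>: "\<And>i. i < m \<Longrightarrow> borel_pinj M (\<phi> i) \<and> \<phi> i \<subseteq> R \<and> \<phi> i \<subseteq> Y \<times> space M \<and> Y - Domain (\<phi> i) \<in> null_sets M"
    and disj: "disjoint_family_on (\<lambda>i. Range (\<phi> i)) {..<m}"
    and meas: "measure M (\<Union>i<m. Range (\<phi> i)) = real m / real n"
    by auto
  let ?U = "\<Union>i<m. Range (\<phi> i)"
  have U: "?U \<in> sets M" using borel_pinj_Range[of M "\<phi> _"] \<phi> by (intro sets.finite_UN) simp_all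
  then have "measure M (space M - ?U) = 1 - real m / real n" using prob_compl meas by simp
  moreover have "real m / real n + 1 / real n \<le> 1"
    using Suc.prems n by (simp add: field_simps)
  ultimately have "measure M Y \<le> measure M (space M - ?U)" using Y(2) by linarith
  then obtain G where G: "borel_pinj M G" "G \<subseteq> R" "G \<subseteq> Y \<times> (space M - ?U)"
      "Y - Domain G \<in> null_sets M"
    using ergodic_partial_automorphism[OF R Y(1), of "space M - ?U"] U by blast
  have dis: "?U \<inter> Range G = {}" using G(3) by blast
  have "measure M (Range G) = 1 / real n"
  proof -
    have "measure M (Y - Domain G) = measure M Y - measure M (Domain G)"
      using G(3) by (intro finite_measure_Diff Y(1) borel_pinj_Domain[OF G(1)]) auto
    moreover have "measure M (Y - Domain G) = 0" using G(4) by (simp add: null_sets_def measure_def)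
    ultimately show ?thesis using pinj_measure_Range[OF G(1,2)] Y(2) by simp
  qed
  then have "measure M (?U \<union> Range G) = real m / real n + 1 / real n"
    using finite_measure_Union[OF U borel_pinj_Range[OF G(1)] dis] meas by simp
  moreover have "(\<Union>i<Suc m. Range ((\<phi>(m := G)) i)) = ?U \<union> Range G"
    by (auto simp: lessThan_Suc)
  ultimately have "measure M (\<Union>i<Suc m. Range ((\<phi>(m := G)) i)) = real (Suc m) / real n"
    by (simp add: add_divide_distrib)
  moreover have "disjoint_family_on (\<lambda>i. Range ((\<phi>(m := G)) i)) {..<Suc m}"
  proof -
    have "disjoint_family_on (\<lambda>i. Range ((\<phi>(m := G)) i)) {..<m}"
      using disj by (simp add: disjoint_family_on_def)
    moreover have "(\<Union>i<m. Range ((\<phi>(m := G)) i)) = ?U" by auto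
    ultimately show ?thesis
      using dis unfolding lessThan_Suc
      by (subst disjoint_family_on_insert)
        (simp_all add: fun_upd_same Int_commute del: fun_upd_apply)
  qed
  moreover have "(\<phi>(m := G)) 0 = Id_on Y" using \<phi>0 Suc.hyps by simp
  moreover have "\<forall>i<Suc m. borel_pinj M ((\<phi>(m := G)) i) \<and> (\<phi>(m := G)) i \<subseteq> R \<and>
      (\<phi>(m := G)) i \<subseteq> Y \<times> space M \<and> Y - Domain ((\<phi>(m := G)) i) \<in> null_sets M"
    using \<phi> G by (auto simp: less_Suc_eq)
  ultimately show ?case by (intro exI[of _ "\<phi>(m := G)"] conjI)
qed

end

subsection \<open>Triviality of the fundamental group\<close>

context II1_equiv_rel
begin

text \<open>Conjugating the pieces of \<open>K\<close> by \<open>H\<close> gives as many pieces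
  generating \<open>R\<close> on the range of \<open>H\<close>, whatever the scale. One more piece
  reaches the set \<open>D\<close> that rounds the measure up to \<open>1 / n\<close>, and the shift
  construction applies.\<close>

lemma isoperimetric_const_le_of_scaling:
  assumes nonatomic: "nonatomic M" and erg: "ergodic_rel M R" and K: "finite_graphing M R K"
    and P: "finite P" "\<Union>P = K" "\<And>g. g \<in> P \<Longrightarrow> borel_pinj M g"
    and H: "scaling M R s H" and s: "0 < s" "s \<le> 1"
  shows "isoperimetric_const M R \<le> of_nat (2 * (card P + 1)) / of_nat (nat \<lfloor>1 / s\<rfloor>)"
proof -
  have fg: "finitely_generated_rel M R" using K unfolding finitely_generated_rel_def by blast
  have KR: "K \<subseteq> R" using K unfolding finite_graphing_def graphing_def by simp
  have Hp: "borel_pinj M H" and Hm: "\<And>E. E \<in> sets M \<Longrightarrow> measure M (H `` E) = s * measure M E"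
    and HR: "\<And>x y x' y'. (x, y) \<in> H \<Longrightarrow> (x', y') \<in> H \<Longrightarrow> (x, x') \<in> R \<longleftrightarrow> (y, y') \<in> R"
    using H unfolding scaling_def by blast+
  have HH: "H `` space M = Range H" using borel_pinjD(1)[OF Hp] by blast
  \<comment> \<open>The largest \<open>n\<close> with \<open>s \<le> 1 / n\<close>. Maximality gives
    \<open>1 / n \<le> 2 * s\<close>, so the filling set \<open>D\<close> is not larger than
    \<open>Y0\<close> and can be matched into it.\<close>
  define n where "n = nat \<lfloor>1 / s\<rfloor>"
  have "1 \<le> 1 / s" using s by simp
  then have "1 \<le> \<lfloor>1 / s\<rfloor>" by simp
  then have n: "0 < n" "real n \<le> 1 / s" "1 / s < real n + 1" unfolding n_def by linarith+
  have sn: "s \<le> 1 / real n" "1 / real n - s \<le> s"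
  proof -
    have ns: "real n * s \<le> 1" "1 < (real n + 1) * s" using n s by (simp_all add: field_simps)
    then show "s \<le> 1 / real n" using n(1) by (simp add: field_simps)
    have "(real n + 1) * s \<le> (2 * real n) * s" using n(1) s by (intro mult_right_mono) auto
    then have "1 \<le> (2 * s) * real n" using ns(2) by (simp add: mult_ac)
    then have "1 / real n \<le> 2 * s" using n(1) by (simp add: pos_divide_le_eq)
    then show "1 / real n - s \<le> s" by simp
  qed
  define Y0 where "Y0 = Range H"
  have Y0: "Y0 \<in> sets M" "measure M Y0 = s"
    unfolding Y0_def using borel_pinj_Range[OF Hp] Hm[of "space M"] HH prob_space by simp_all
  define Dc where "Dc = space M - Domain H"
  have Dc: "Dc \<in> null_sets M"
  proof (rule null_setsI_measure)
    show "Dc \<in> sets M" unfolding Dc_def using borel_pinj_Domain[OF Hp] by simp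
    \<comment> \<open>The empty image has measure \<open>s\<close> times that of \<open>Dc\<close>,
      and \<open>s\<close> is positive.\<close>
    moreover have "H `` Dc = {}" unfolding Dc_def by blast
    ultimately show "measure M Dc = 0" using Hm[of Dc] s by simp
  qed
  have "1 / real n - s \<le> measure M (space M - Y0)"
    using n(1) Y0 prob_compl[OF Y0(1)] by simp
  then obtain D where D: "D \<in> sets M" "D \<subseteq> space M - Y0" "measure M D = 1 / real n - s"
    using nonatomic_intermediate_value[OF nonatomic, of "space M - Y0" "1 / real n - s"] Y0(1) sn
    by auto
  define Y where "Y = Y0 \<union> D"
  have Y: "Y \<in> sets M" "measure M Y = 1 / real n"
    unfolding Y_def using D Y0 finite_measure_Union[of Y0 D] by auto
  obtain \<theta> where \<theta>: "borel_pinj M \<theta>" "\<theta> \<subseteq> R" "\<theta> \<subseteq> D \<times> Y0" "D - Domain \<theta> \<in> null_sets M"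
    using ergodic_partial_automorphism[OF fg erg D(1) Y0(1)] D(3) Y0(2) sn(2) by auto
  have n1: "1 \<le> n" using n(1) by simp
  obtain \<phi> where \<phi>0: "\<phi> 0 = Id_on Y"
    and \<phi>: "\<forall>i<n. borel_pinj M (\<phi> i) \<and> \<phi> i \<subseteq> R \<and> \<phi> i \<subseteq> Y \<times> space M \<and> Y - Domain (\<phi> i) \<in> null_sets M"
    and disj: "disjoint_family_on (\<lambda>i. Range (\<phi> i)) {..<n}"
    and full: "measure M (\<Union>i<n. Range (\<phi> i)) = real n / real n"
    using partial_copies[OF fg erg Y n(1) n1 order_refl] by blast
  obtain W N0 where WN: "countable W \<and> (\<forall>w\<in>W. borel_pinj M w \<and> w \<subseteq> R) \<and>
      N0 \<in> null_sets M \<and> R `` N0 \<subseteq> N0 \<and>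
      (\<forall>x y. (x, y) \<in> R \<longrightarrow> x \<notin> N0 \<longrightarrow> (x, y) \<in> (K \<union> K\<inverse>)\<^sup>* \<and> (\<exists>w\<in>W. (x, y) \<in> w))"
    using finite_graphing_countable_cover[OF K] by (elim exE) (rule that)
  then have N0: "N0 \<in> null_sets M"
    and K_path: "\<And>x y. (x, y) \<in> R \<Longrightarrow> x \<notin> N0 \<Longrightarrow> (x, y) \<in> (K \<union> K\<inverse>)\<^sup>*"
    by simp_all
  let ?H = "H `` (N0 \<union> R `` Dc)"
  \<comment> \<open>All exceptional points, to be saturated into \<open>N\<close>. The class of
    \<open>Dc\<close> is discarded, not just \<open>Dc\<close>, because every vertex of a lifted
    path must lie in the domain of \<open>H\<close>.\<close>
  define B where "B = (D - Domain \<theta>) \<union> (\<Union>i<n. Y - Domain (\<phi> i)) \<union>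
    (space M - (\<Union>i<n. Range (\<phi> i))) \<union> ?H"
  have "B \<in> null_sets M"
    unfolding B_def
  proof (intro null_sets.Un \<theta>(4) null_sets_UN')
    show "Y - Domain (\<phi> i) \<in> null_sets M" if "i \<in> {..<n}" for i using \<phi> that by simp
    have "(\<Union>i<n. Range (\<phi> i)) \<in> sets M"
      using borel_pinj_Range[of M "\<phi> _"] \<phi> by (intro sets.finite_UN) simp_all
    then show "space M - (\<Union>i<n. Range (\<phi> i)) \<in> null_sets M"
      using full n(1) prob_compl by (intro null_setsI_measure) auto
    have "N0 \<union> R `` Dc \<in> null_sets M" using N0 R_null[OF Dc] by (rule null_sets.Un)
    then have "N0 \<union> R `` Dc \<in> sets M" "measure M (N0 \<union> R `` Dc) = 0"
      by (auto simp: null_sets_def measure_def)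
    then show "?H \<in> null_sets M"
      using borel_pinjD(4)[OF Hp] Hm by (intro null_setsI_measure) simp_all
  qed simp
  define N where "N = R `` B"
  have N: "N \<in> null_sets M" "R `` N \<subseteq> N"
    unfolding N_def using R_null[OF \<open>B \<in> null_sets M\<close>] R_saturation_idem by simp_all
  have BN: "B \<subseteq> N"
    unfolding N_def using sets.sets_into_space[OF null_setsD2[OF \<open>B \<in> null_sets M\<close>]]
    by (rule R_saturation_sup)
  have N_sat: "y \<notin> N" if "x \<notin> N" "(x, y) \<in> R" for x y
    using that N(2) R_sym[OF that(2)] by blast
  define \<G> where "\<G> = insert \<theta> ((\<lambda>g. H\<inverse> O g O H) ` P)"
  define L where "L = \<Union>\<G> \<union> (\<Union>\<G>)\<inverse>"
  have P_lift: "(y, z) \<in> L" if "(x, y) \<in> H" "(w, z) \<in> H" "(x, w) \<in> K \<union> K\<inverse>" for x y z w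
  proof -
    have *: "(y, z) \<in> \<Union>\<G>" if h: "(x, y) \<in> H" "(w, z) \<in> H" "(x, w) \<in> K" for x y z w
    proof -
      obtain g where "g \<in> P" "(x, w) \<in> g" using h(3) P(2) by blast
      then have "(y, z) \<in> H\<inverse> O g O H" "H\<inverse> O g O H \<in> \<G>" using h(1,2) unfolding \<G>_def by blast+
      then show ?thesis by blast
    qed
    show ?thesis using that *[of x y w z] *[of w z x y] unfolding L_def by blast
  qed
  have path_Y0: "(x, y) \<in> L\<^sup>*" if x: "x \<in> Y0" "x \<notin> N" and y: "y \<in> Y0" and xy: "(x, y) \<in> R" for x y
  proof -
    obtain u v where uv: "(u, x) \<in> H" "(v, y) \<in> H" using x(1) y unfolding Y0_def by blast
    have u: "u \<notin> N0" "u \<notin> R `` Dc" using x(2) BN uv(1) unfolding B_def by blast+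
    have "u \<in> space M" using uv(1) borel_pinjD(1)[OF Hp] by blast
    have uvR: "(u, v) \<in> R" using HR[OF uv] xy by simp
    have "(u, v) \<in> (K \<union> K\<inverse>)\<^sup>*" using K_path[OF uvR u(1)] .
    \<comment> \<open>The path is pushed forward along \<open>H\<close> vertex by vertex. Keeping
      \<open>(u, v) \<in> R\<close> in the invariant shows that the next vertex avoids
      \<open>Dc\<close>, since \<open>u\<close> is outside the saturation of
      \<open>Dc\<close>.\<close>
    then have "\<exists>z. (v, z) \<in> H \<and> (u, v) \<in> R \<and> (x, z) \<in> L\<^sup>*"
    proof (induction rule: rtrancl_induct)
      case base
      then show ?case using uv(1) R_refl[OF \<open>u \<in> space M\<close>] by blast
    next
      case (step v w)
      then obtain z where z: "(v, z) \<in> H" "(u, v) \<in> R" "(x, z) \<in> L\<^sup>*" by blast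
      have "(v, w) \<in> R" using step.hyps(2) KR R_sym by blast
      then have uw: "(u, w) \<in> R" using z(2) R_trans by blast
      then have "w \<in> space M" "w \<notin> Dc" using R_sub R_sym[OF uw] u(2) by blast+
      then obtain z' where z': "(w, z') \<in> H" unfolding Dc_def by blast
      then have "(z, z') \<in> L" using P_lift z(1) step.hyps(2) by blast
      then have "(x, z') \<in> L\<^sup>*" using z(3) by (rule rtrancl_into_rtrancl[rotated])
      then show ?case using z' uw by blast
    qed
    then obtain z where "(v, z) \<in> H" "(x, z) \<in> L\<^sup>*" by blast
    then show ?thesis using borel_pinjD(2)[OF Hp uv(2)] by blast
  qed
  have to_Y0: "\<exists>z\<in>Y0. z \<notin> N \<and> (x, z) \<in> R \<and> (x, z) \<in> L\<^sup>* \<and> (z, x) \<in> L\<^sup>*" if x: "x \<in> Y" "x \<notin> N" for x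
  proof (cases "x \<in> Y0")
    case True
    then show ?thesis using x(2) R_refl sets.sets_into_space[OF Y(1)] x(1) by blast
  next
    case False
    then have "x \<in> D" using x(1) by (simp add: Y_def)
    then have "x \<in> Domain \<theta>" using x(2) BN unfolding B_def by blast
    then obtain z where z: "(x, z) \<in> \<theta>" by blast
    then have zR: "(x, z) \<in> R" "z \<in> Y0" using \<theta>(2,3) by blast+
    have "(x, z) \<in> L" "(z, x) \<in> L" using z unfolding L_def \<G>_def by blast+
    then show ?thesis using zR N_sat[OF x(2) zR(1)] by blast
  qed
  interpret sh: shift_system M R Y N n \<phi> \<G>
  proof
    show "0 < n" by fact
    show "\<phi> 0 = Id_on Y" by fact
    show "borel_pinj M (\<phi> i)" "\<phi> i \<subseteq> R" if "i < n" for i using \<phi> that by blast+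
    show "finite \<G>" unfolding \<G>_def using P(1) by simp
    show "borel_pinj M g" if "g \<in> \<G>" for g
      using that P(3) \<theta>(1) borel_pinj_relcomp borel_pinj_converse Hp unfolding \<G>_def by blast
    show "g \<subseteq> R" if "g \<in> \<G>" for g
    proof -
      consider "g = \<theta>" | p where "p \<in> P" "g = H\<inverse> O p O H" using \<open>g \<in> \<G>\<close> unfolding \<G>_def by blast
      then show ?thesis
      proof cases
        case 2
        then have "p \<subseteq> R" using P(2) KR by blast
        then show ?thesis unfolding 2(2) using HR by blast
      qed (use \<theta>(2) in simp)
    qed
    show "g \<subseteq> Y \<times> Y" if "g \<in> \<G>" for g
      using that \<theta>(3) unfolding \<G>_def Y_def Y0_def by blast
    show "N \<in> null_sets M" "R `` N \<subseteq> N" by fact+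
    show "y \<in> Domain (\<phi> i)" if "i < n" "y \<in> Y" "y \<notin> N" for i y
      using that BN unfolding B_def by blast
    show "y \<in> Y" if "i < n" "(y, x) \<in> \<phi> i" for i y x
      using \<phi> that by blast
    show "\<exists>i<n. x \<in> Range (\<phi> i)" if "x \<in> space M" "x \<notin> N" for x
      using that BN unfolding B_def by blast
    show "i = j" if "i < n" "j < n" "(y, x) \<in> \<phi> i" "(z, x) \<in> \<phi> j" for i j x y z
      using disjoint_family_onD[OF disj, of i j] that by blast
    show "(x, y) \<in> (\<Union>\<G> \<union> (\<Union>\<G>)\<inverse>)\<^sup>*" if x: "x \<in> Y" "x \<notin> N" and y: "y \<in> Y" and xy: "(x, y) \<in> R" for x y
    proof -
      obtain x' where x': "x' \<in> Y0" "x' \<notin> N" "(x, x') \<in> R" "(x, x') \<in> L\<^sup>*" using to_Y0[OF x] by blast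
      obtain y' where y': "y' \<in> Y0" "(y, y') \<in> R" "(y', y) \<in> L\<^sup>*" using to_Y0[OF y N_sat[OF x(2) xy]] by blast
      have "(x', y') \<in> R" using R_trans[OF R_sym[OF x'(3)] R_trans[OF xy y'(2)]] .
      then have "(x', y') \<in> L\<^sup>*" using path_Y0 x' y' by blast
      then show ?thesis using x'(4) y'(3) unfolding L_def[symmetric] by (meson rtrancl_trans)
    qed
  qed
  \<comment> \<open>The extra piece is \<open>\<theta>\<close>; conjugates may coincide, hence an
    inequality.\<close>
  have "card \<G> \<le> card P + 1"
    unfolding \<G>_def using P(1) card_insert_le_m1 card_image_le[OF P(1), of "\<lambda>g. H\<inverse> O g O H"]
    by (simp add: card_insert_if)
  then have "(of_nat (2 * card \<G>) :: ennreal) \<le> of_nat (2 * (card P + 1))"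
    by (intro of_nat_mono) simp
  then have "(of_nat (2 * card \<G>) :: ennreal) / of_nat n \<le> of_nat (2 * (card P + 1)) / of_nat n"
    by (rule divide_right_mono_ennreal)
  then show ?thesis using sh.isoperimetric_const_le unfolding n_def by (rule order_trans[rotated])
qed

end

section \<open>Letting the number of copies grow\<close>

lemma ennreal_of_nat_divide_left_mono:
  assumes "0 < m" "m \<le> n"
  shows "(of_nat C / of_nat n :: ennreal) \<le> of_nat C / of_nat m"
proof -
  have "real C / real n \<le> real C / real m"
    using assms by (intro divide_left_mono mult_pos_pos) auto
  then show ?thesis
    using assms unfolding ennreal_of_nat_eq_real_of_nat
    by (subst (1 2) divide_ennreal) (auto intro: ennreal_leI)
qed

lemma ennreal_eq_0_if_le_const_divide:
  fixes h :: ennreal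
  assumes "\<And>m. 0 < m \<Longrightarrow> h \<le> of_nat C / of_nat m"
  shows "h = 0"
proof -
  have le: "h \<le> ennreal (real C / real m)" if "0 < m" for m
    using assms[OF that] that by (simp add: ennreal_of_nat_eq_real_of_nat divide_ennreal)
  obtain r where r: "0 \<le> r" "h = ennreal r"
    using le[of 1] by (cases h) (auto simp: top_unique)
  have "r * real m \<le> real C" if "0 < m" for m
    using le[OF that] that r by (simp add: field_simps)
  then have "r \<le> 0"
    by (metis ex_less_of_nat_mult gr0I less_le_not_le linorder_not_le mult.commute mult_zero_left of_nat_0 of_nat_0_le_iff order_le_less_trans)
  then show ?thesis using r by simp
qed

lemma generate_pos_real_group_one:
  assumes "S \<subseteq> {1}"
  shows "generate pos_real_group S = {1}"
proof -
  have inv_1: "inv\<^bsub>pos_real_group\<^esub> 1 = 1"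
    unfolding m_inv_def pos_real_group_def by (rule the_equality) auto
  have "x = 1" if "x \<in> generate pos_real_group S" for x
    using that
  proof (induction rule: generate.induct)
    case (incl h)
    then show ?case using assms by blast
  next
    case (inv h)
    then have "h = 1" using assms by blast
    then show ?case using inv_1 by simp
  qed (simp_all add: pos_real_group_def)
  moreover have "1 \<in> generate pos_real_group S"
    using generate.one[of pos_real_group S] by (simp add: pos_real_group_def)
  ultimately show ?thesis by blast
qed

theorem corollary16:
  fixes M :: "'a measure" and R :: "('a \<times> 'a) set"
  assumes "standard_nonatomic_prob_space M"
    and "measured_equiv_rel M R"
    and "finitely_generated_rel M R"
    and "ergodic_rel M R"
    and "type_II1 M R"
    and "uniformly_nonamenable M R"
  shows "fundamental_group M R = {1}"
  unfolding fundamental_group_def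
proof (rule generate_pos_real_group_one, rule subsetI)
  have M: "prob_space M" "standard_borel M" "nonatomic M"
    using assms(1) unfolding standard_nonatomic_prob_space_def by auto
  interpret prob_space M by fact
  interpret II1_equiv_rel M R by unfold_locales (use M assms in auto)
  obtain K where K: "finite_graphing M R K" using assms(3) unfolding finitely_generated_rel_def by blast
  then obtain P where P: "finite P" "partition_on K P"
      "\<forall>G\<in>P. \<exists>A B f. partial_automorphism M R A B f \<and> G = graph_on A f"
    unfolding finite_graphing_def by blast
  have P_pinj: "borel_pinj M g" if "g \<in> P" for g
    using bspec[OF P(3) that] borel_pinj_iff_partial_automorphism[of M g R] by simp
  have UP: "\<Union>P = K" using P(2) by (simp add: partition_on_def)
  fix t assume "t \<in> {measure M Y | Y. Y \<in> sets M \<and> emeasure M Y > 0 \<and>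
    isomorphic_rel (normalized_restriction M Y) (restrict_rel R Y) M R}"
  then obtain Y where Y: "t = measure M Y" "Y \<in> sets M" "emeasure M Y > 0"
      "isomorphic_rel (normalized_restriction M Y) (restrict_rel R Y) M R"
    by blast
  obtain H where H: "scaling M R t H"
    using isomorphic_rel_imp_scaling[OF M(1) Y(2-4)] Y(1) by blast
  have t: "0 < t" "t \<le> 1" using Y(1,3) by (simp_all add: emeasure_eq_measure)
  have "t = 1"
  proof (rule ccontr)
    assume "t \<noteq> 1"
    have "isoperimetric_const M R \<le> of_nat (2 * (card P + 1)) / of_nat m" if m: "0 < m" for m
    proof -
      \<comment> \<open>A scale below \<open>1 / m\<close> allows at least \<open>m\<close> copies.
        Powers of \<open>t\<close> get there because \<open>t\<close>, the measure of a subset, is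
        at most 1 and differs from 1.\<close>
      obtain k where k: "t ^ k < 1 / real m"
        using real_arch_pow_inv[of "1 / real m" t] t \<open>t \<noteq> 1\<close> m by auto
      obtain H' where H': "scaling M R (t ^ k) H'" using scaling_power[OF H] by blast
      have tk: "0 < t ^ k" "t ^ k \<le> 1" using t by (simp_all add: power_le_one)
      let ?n = "nat \<lfloor>1 / t ^ k\<rfloor>"
      have "real m \<le> 1 / t ^ k" using k tk m by (simp add: field_simps)
      then have "m \<le> ?n" by linarith
      have "isoperimetric_const M R \<le> of_nat (2 * (card P + 1)) / of_nat ?n"
        by (rule isoperimetric_const_le_of_scaling[OF M(3) assms(4) K P(1) UP P_pinj H' tk])
      also have "\<dots> \<le> of_nat (2 * (card P + 1)) / of_nat m"
        using m \<open>m \<le> ?n\<close> by (rule ennreal_of_nat_divide_left_mono)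
      finally show ?thesis .
    qed
    then have "isoperimetric_const M R = 0" by (rule ennreal_eq_0_if_le_const_divide)
    then show False using assms(6) unfolding uniformly_nonamenable_def by simp
  qed
  then show "t \<in> {1}" by simp
qed

end
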